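(* Let $G$ be a primitive group of diagonal type. Then the relational complexity of $G$ satisfies $\mathrm{RC}(G)\geqslant 4$.
   Context: Diagonal type groups. Let $k\geqslant 2$ be an integer and $T$ a non-abelian finite simple group. Define $W_0=\{(\varphi_1,\dots,\varphi_k)\sigma\in \mathrm{Aut}(T)\wr \mathrm{S}_k : \mathrm{Inn}(T)\varphi_1=\mathrm{Inn}(T)\varphi_i \text{ for all } i\}$, $D_0=\{(\varphi,\dots,\varphi)\sigma : \varphi\in\mathrm{Aut}(T),\ \sigma\in \mathrm{S}_k\}\leqslant W_0$, and let $\Omega=[W_0:D_0]$ be the set of right cosets of $D_0$ in $W_0$, so $|\Omega|=|T|^{k-1}$. Then $W_0$ acts faithfully on $\Omega$ by right multiplication. Write $T^k$ for $\mathrm{Inn}(T)^k\leqslant W_0$. A subgroup $G$ of $\mathrm{Sym}(\Omega)$ is of diagonal type if, for some such $k$ and $T$, $T^k\trianglelefteq G\leqslant W_0$. Relational complexity. Let $G\leqslant \mathrm{Sym}(\Omega)$, let $s\leqslant t$ be positive integers, and let $\Lambda=(\lambda_1,\dots,\lambda_t),\Sigma=(\sigma_1,\dots,\sigma_t)\in\Omega^t$. Write $\Lambda\sim_s\Sigma$ if for every subset of $s$ indices $i_1,\dots,i_s$ there exists $g\in G$ such that $\lambda_{i_j}^g=\sigma_{i_j}$ for all $j\in\{1,\dots,s\}$. The relational complexity $\mathrm{RC}(G)$ is the smallest $s\geqslant 2$ such that for all $t\geqslant s$ and all $\Lambda,\Sigma\in\Omega^t$, if $\Lambda\sim_s\Sigma$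 then $\Lambda\in\Sigma^G$ (where $G$ acts coordinatewise on $\Omega^t$). *)

theory Defs
  imports "HOL-Algebra.Algebra" "HOL-Library.Disjoint_Sets"
begin

text \<open>
  Composition in \<^const>\<open>AutoGroup\<close>, \<^const>\<open>BijGroup\<close> and \<^const>\<open>sym_group\<close> is written with the
  function applied first on the right. The wreath product follows the same convention: \<open>\<sigma>\<close> moves
  the \<open>i\<close>-th coordinate to position \<open>\<sigma> i\<close>, and \<open>(f, \<sigma>)\<close> stands for the product of \<open>f\<close> in the
  base group with \<open>\<sigma>\<close> in the top group. Inverting all automorphisms and permutations is an
  isomorphism onto the wreath product formed with maps written on the right.
\<close>

definition wreath_sym :: "('a, 'b) monoid_scheme \<Rightarrow> nat \<Rightarrow> ((nat \<Rightarrow> 'a) \<times> (nat \<Rightarrow> nat)) monoid"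
  where "wreath_sym A k =
    \<lparr>carrier = carrier (product_group {1..k} (\<lambda>_. A)) \<times> carrier (sym_group k),
     monoid.mult = (\<lambda>(f, \<sigma>) (g, \<tau>).
       (f \<otimes>\<^bsub>product_group {1..k} (\<lambda>_. A)\<^esub> (\<lambda>i\<in>{1..k}. g (inv_into UNIV \<sigma> i)),
        \<sigma> \<otimes>\<^bsub>sym_group k\<^esub> \<tau>)),
     one = (\<one>\<^bsub>product_group {1..k} (\<lambda>_. A)\<^esub>, \<one>\<^bsub>sym_group k\<^esub>)\<rparr>"

definition Inn :: "('a, 'b) monoid_scheme \<Rightarrow> ('a \<Rightarrow> 'a) set"
  where "Inn T = (\<lambda>g. \<lambda>x\<in>carrier T. g \<otimes>\<^bsub>T\<^esub> x \<otimes>\<^bsub>T\<^esub> inv\<^bsub>T\<^esub> g) ` carrier T"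

definition diag_W0 :: "nat \<Rightarrow> ('a, 'b) monoid_scheme \<Rightarrow> ((nat \<Rightarrow> 'a \<Rightarrow> 'a) \<times> (nat \<Rightarrow> nat)) set"
  where "diag_W0 k T =
    {(\<phi>, \<sigma>) \<in> carrier (wreath_sym (AutoGroup T) k).
       \<forall>i\<in>{1..k}. Inn T #>\<^bsub>AutoGroup T\<^esub> \<phi> 1 = Inn T #>\<^bsub>AutoGroup T\<^esub> \<phi> i}"

definition diag_D0 :: "nat \<Rightarrow> ('a, 'b) monoid_scheme \<Rightarrow> ((nat \<Rightarrow> 'a \<Rightarrow> 'a) \<times> (nat \<Rightarrow> nat)) set"
  where "diag_D0 k T =
    {(\<lambda>i\<in>{1..k}. \<phi>, \<sigma>) | \<phi> \<sigma>. \<phi> \<in> carrier (AutoGroup T) \<and> \<sigma> \<in> carrier (sym_group k)}"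

definition diag_base :: "nat \<Rightarrow> ('a, 'b) monoid_scheme \<Rightarrow> ((nat \<Rightarrow> 'a \<Rightarrow> 'a) \<times> (nat \<Rightarrow> nat)) set"
  where "diag_base k T = {(\<phi>, id) | \<phi>. \<phi> \<in> (\<Pi>\<^sub>E i\<in>{1..k}. Inn T)}"

definition diag_points ::
    "nat \<Rightarrow> ('a, 'b) monoid_scheme \<Rightarrow> ((nat \<Rightarrow> 'a \<Rightarrow> 'a) \<times> (nat \<Rightarrow> nat)) set set"
  where "diag_points k T =
    rcosets\<^bsub>(wreath_sym (AutoGroup T) k)\<lparr>carrier := diag_W0 k T\<rparr>\<^esub> (diag_D0 k T)"

text \<open>
  Right multiplication composes in reverse order, so \<open>diag_perm k T\<close> is an anti-homomorphism into
  \<^const>\<open>BijGroup\<close>; its images of subgroups are nevertheless subgroups.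
\<close>

definition diag_perm :: "nat \<Rightarrow> ('a, 'b) monoid_scheme \<Rightarrow> (nat \<Rightarrow> 'a \<Rightarrow> 'a) \<times> (nat \<Rightarrow> nat) \<Rightarrow>
    ((nat \<Rightarrow> 'a \<Rightarrow> 'a) \<times> (nat \<Rightarrow> nat)) set \<Rightarrow> ((nat \<Rightarrow> 'a \<Rightarrow> 'a) \<times> (nat \<Rightarrow> nat)) set"
  where "diag_perm k T w = (\<lambda>C\<in>diag_points k T. C #>\<^bsub>wreath_sym (AutoGroup T) k\<^esub> w)"

abbreviation perm_group :: "'a set \<Rightarrow> ('a \<Rightarrow> 'a) set \<Rightarrow> ('a \<Rightarrow> 'a) monoid"
  where "perm_group \<Omega> G \<equiv> (BijGroup \<Omega>)\<lparr>carrier := G\<rparr>"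

definition diagonal_type ::
    "((nat \<Rightarrow> 'a \<Rightarrow> 'a) \<times> (nat \<Rightarrow> nat)) set set \<Rightarrow>
     (((nat \<Rightarrow> 'a \<Rightarrow> 'a) \<times> (nat \<Rightarrow> nat)) set \<Rightarrow> ((nat \<Rightarrow> 'a \<Rightarrow> 'a) \<times> (nat \<Rightarrow> nat)) set) set \<Rightarrow> bool"
  where "diagonal_type \<Omega> G \<longleftrightarrow>
    (\<exists>(k::nat) (T::'a monoid).
       k \<ge> 2 \<and> simple_group T \<and> finite (carrier T) \<and> \<not> comm_group T \<and>
       \<Omega> = diag_points k T \<and>
       subgroup G (BijGroup \<Omega>) \<and>
       diag_perm k T ` diag_base k T \<lhd> perm_group \<Omega> G \<and>
       G \<subseteq> diag_perm k T ` diag_W0 k T)"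

definition primitive_group :: "'a set \<Rightarrow> ('a \<Rightarrow> 'a) set \<Rightarrow> bool"
  where "primitive_group \<Omega> G \<longleftrightarrow>
    transitive_action (perm_group \<Omega> G) \<Omega> (\<lambda>g. g) \<and>
    (\<forall>P. partition_on \<Omega> P \<and> (\<forall>g\<in>G. \<forall>B\<in>P. g ` B \<in> P) \<longrightarrow>
       P = {\<Omega>} \<or> P = (\<lambda>x. {x}) ` \<Omega>)"

text \<open>Tuples of points are lists; the indices run from \<open>0\<close>. For finite \<open>\<Omega>\<close> the
  least number below exists: \<open>s = card \<Omega> + 2\<close> has the required property.\<close>

definition tuple_equiv :: "('a \<Rightarrow> 'a) set \<Rightarrow> nat \<Rightarrow> 'a list \<Rightarrow> 'a list \<Rightarrow> bool"
  where "tuple_equiv G s \<Lambda> \<Sigma> \<longleftrightarrow>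
    (\<forall>I. I \<subseteq> {..<length \<Lambda>} \<and> card I = s \<longrightarrow> (\<exists>g\<in>G. \<forall>i\<in>I. g (\<Lambda> ! i) = \<Sigma> ! i))"

definition relational_complexity :: "'a set \<Rightarrow> ('a \<Rightarrow> 'a) set \<Rightarrow> nat"
  where "relational_complexity \<Omega> G =
    (LEAST s. s \<ge> 2 \<and>
       (\<forall>t\<ge>s. \<forall>\<Lambda> \<Sigma>. length \<Lambda> = t \<and> length \<Sigma> = t \<and> set \<Lambda> \<subseteq> \<Omega> \<and> set \<Sigma> \<subseteq> \<Omega> \<and>
          tuple_equiv G s \<Lambda> \<Sigma> \<longrightarrow> (\<exists>g\<in>G. \<Lambda> = map g \<Sigma>)))"

end

theory Submission
  imports Defs
begin

text \<open>
  The proof exhibits, for each group \<open>G\<close> of diagonal type, two tuples that are equivalent on all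
  triples of entries but are not in one orbit. The points \<open>point x\<close>, for \<open>x\<close> in the simple group
  \<open>T\<close>, are the cosets of the elements of \<open>T\<^sup>k\<close> that have \<open>x\<close> in the second coordinate and are trivial
  elsewhere. The base group sends \<open>point x\<close> to \<open>point (g\<inverse> x h)\<close> for all \<open>g\<close> and \<open>h\<close>, and by
  \<open>stabilizer_of_point_one\<close> an element of \<open>W\<^sub>0\<close> that fixes \<open>point 1\<close> acts on these points through an
  automorphism of \<open>T\<close>, possibly composed with inversion.

  Take non-commuting \<open>a\<close> and \<open>b\<close> in \<open>T\<close>, and let both tuples consist of the points of the elements of
  \<open>C(a)\<close> and of \<open>b\<close>, followed by the point of \<open>ab\<close> in the first tuple and of \<open>ba\<close> in the second.
  Conjugation by \<open>a\<close> takes \<open>ab\<close> to \<open>ba\<close> and fixes \<open>C(a)\<close>; for \<open>c\<close> in \<open>C(a)\<close> the map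
  \<open>x \<mapsto> b c\<inverse> x b\<inverse> c\<close> also takes \<open>ab\<close> to \<open>ba\<close>, and it fixes \<open>b\<close> and \<open>c\<close>. So the tuples are equivalent on
  all triples (\<open>tuple_equiv_three_ab_ba\<close>). An element taking one tuple to the other would give
  either an automorphism fixing \<open>a\<close> and \<open>b\<close> and taking \<open>ab\<close> to \<open>ba\<close>, which is absurd, or an
  automorphism inverting \<open>b\<close> and every element of \<open>C(a)\<close>. It remains to choose \<open>a\<close> and \<open>b\<close> such that
  no automorphism of the second kind exists
  (\<open>ex_noncommuting_not_inverted\<close>).

  If there were no such pair, then all centralizers of non-trivial elements would be abelian, since
  an automorphism inverting them exists, so distinct ones would intersect trivially; and each of them
  would have index at most \<open>2\<close> in its normalizer, the other elements of the normalizer acting by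
  inversion. Then the non-trivial elements of each conjugacy class of centralizers make up at
  least a third of the group, so there are at most two classes, and the orders of their members
  cannot add up unless some centralizer is normal.
\<close>

section \<open>Lower bounds for the relational complexity\<close>

lemma tuple_equiv_antimono:
  assumes "tuple_equiv G s \<Lambda> \<Sigma>" "r \<le> s" "s \<le> length \<Lambda>"
  shows "tuple_equiv G r \<Lambda> \<Sigma>"
  unfolding tuple_equiv_def
proof (intro allI impI, elim conjE)
  fix I assume I: "I \<subseteq> {..<length \<Lambda>}" "card I = r"
  then obtain J where "I \<subseteq> J" "J \<subseteq> {..<length \<Lambda>}" "card J = s"
    using exists_subset_between[of I s "{..<length \<Lambda>}"] assms by auto
  then show "\<exists>g\<in>G. \<forall>i\<in>I. g (\<Lambda> ! i) = \<Sigma> ! i"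
    using assms(1) unfolding tuple_equiv_def by blast
qed

text \<open>
  A set of at most \<open>card \<Omega>\<close> indices represents all entries of \<open>\<Lambda>\<close>. An element that is right on these
  indices is right everywhere, because equivalence on pairs makes equal entries of \<open>\<Lambda>\<close> correspond
  to equal entries of \<open>\<Sigma>\<close>.
\<close>

lemma tuple_equiv_card_plus_two:
  assumes "finite \<Omega>" "subgroup G (BijGroup \<Omega>)"
    and len: "length \<Lambda> = t" "length \<Sigma> = t" "card \<Omega> + 2 \<le> t"
    and sub: "set \<Lambda> \<subseteq> \<Omega>" "set \<Sigma> \<subseteq> \<Omega>"
    and equiv: "tuple_equiv G (card \<Omega> + 2) \<Lambda> \<Sigma>"
  shows "\<exists>g\<in>G. \<Lambda> = map g \<Sigma>"
proof -
  have extend: "\<exists>g\<in>G. \<forall>i\<in>I. g (\<Lambda> ! i) = \<Sigma> ! i"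
    if I: "I \<subseteq> {..<t}" "card I \<le> card \<Omega> + 2" for I
    using tuple_equiv_antimono[OF equiv I(2)] I(1) len by (auto simp: tuple_equiv_def)
  obtain J where J: "J \<subseteq> {..<t}" "inj_on ((!) \<Lambda>) J" "(!) \<Lambda> ` {..<t} = (!) \<Lambda> ` J"
    using subset_image_inj[THEN iffD1, OF order_refl] by meson
  have "(!) \<Lambda> ` J \<subseteq> \<Omega>" using J(1) sub(1) len by (auto simp: subset_iff)
  then have "card J \<le> card \<Omega>" using card_image[OF J(2)] card_mono[OF assms(1)] by metis
  then obtain g where g: "g \<in> G" "\<forall>i\<in>J. g (\<Lambda> ! i) = \<Sigma> ! i" using extend[OF J(1)] by auto
  have gi: "g (\<Lambda> ! i) = \<Sigma> ! i" if i: "i < t" for i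
  proof -
    obtain j where j: "j \<in> J" "\<Lambda> ! i = \<Lambda> ! j" using J(3) i by blast
    have "card {i, j} \<le> card \<Omega> + 2" by (simp add: card_insert_if)
    moreover have "{i, j} \<subseteq> {..<t}" using i j(1) J(1) by auto
    ultimately obtain h where "\<forall>m\<in>{i, j}. h (\<Lambda> ! m) = \<Sigma> ! m"
      using extend[of "{i, j}"] by blast
    then have "h (\<Lambda> ! i) = \<Sigma> ! i" and "h (\<Lambda> ! j) = \<Sigma> ! j" by blast+
    then have "\<Sigma> ! i = \<Sigma> ! j" unfolding j(2) by (rule trans[OF sym])
    then show ?thesis using j g by simp
  qed
  have gB: "g \<in> Bij \<Omega>" using subgroup.subset[OF assms(2)] g by (auto simp: BijGroup_def)
  define h where "h = inv\<^bsub>BijGroup \<Omega>\<^esub> g"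
  have "h \<in> G" using subgroup.m_inv_closed[OF assms(2)] g h_def by simp
  moreover have "h (\<Sigma> ! i) = \<Lambda> ! i" if i: "i < t" for i
  proof -
    have "\<Lambda> ! i \<in> \<Omega>" using sub i len by auto
    moreover have "inj_on g \<Omega>" "g ` \<Omega> = \<Omega>" using gB by (auto simp: Bij_def bij_betw_def)
    ultimately show ?thesis
      using gi[OF i] inv_into_f_f[of g \<Omega> "\<Lambda> ! i"] gB
      by (metis h_def imageI inv_BijGroup restrict_apply')
  qed
  ultimately show ?thesis using len by (intro bexI[of _ h]) (auto intro!: nth_equalityI)
qed

text \<open>
  Some number has the defining property by \<open>tuple_equiv_card_plus_two\<close>, so the least one has it too. A failure at \<open>s\<close> is also a
  failure at every smaller number, because equivalence on \<open>s\<close> indices implies equivalence on fewer.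
\<close>

lemma relational_complexity_greater:
  assumes "finite \<Omega>" "subgroup G (BijGroup \<Omega>)"
    and "length \<Sigma> = length \<Lambda>" "s \<le> length \<Lambda>" "set \<Lambda> \<subseteq> \<Omega>" "set \<Sigma> \<subseteq> \<Omega>"
    and "tuple_equiv G s \<Lambda> \<Sigma>" "\<not> (\<exists>g\<in>G. \<Lambda> = map g \<Sigma>)"
  shows "s < relational_complexity \<Omega> G"
proof (rule ccontr)
  define P where "P s \<longleftrightarrow> s \<ge> 2 \<and> (\<forall>t\<ge>s. \<forall>\<Lambda> \<Sigma>. length \<Lambda> = t \<and> length \<Sigma> = t \<and> set \<Lambda> \<subseteq> \<Omega> \<and>
    set \<Sigma> \<subseteq> \<Omega> \<and> tuple_equiv G s \<Lambda> \<Sigma> \<longrightarrow> (\<exists>g\<in>G. \<Lambda> = map g \<Sigma>))" for s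
  have "P (card \<Omega> + 2)"
    unfolding P_def using tuple_equiv_card_plus_two[OF assms(1,2)] by auto
  then have P: "P (relational_complexity \<Omega> G)"
    unfolding relational_complexity_def P_def by (rule LeastI)
  assume "\<not> s < relational_complexity \<Omega> G"
  then have le: "relational_complexity \<Omega> G \<le> s" by simp
  then have "tuple_equiv G (relational_complexity \<Omega> G) \<Lambda> \<Sigma>"
    using tuple_equiv_antimono assms by blast
  moreover have "relational_complexity \<Omega> G \<le> length \<Lambda>" using le assms(4) by simp
  ultimately show False using P assms(3,5,6,8) unfolding P_def by blast
qed

section \<open>Centralizers and their conjugates\<close>

definition centralizer :: "('a, 'b) monoid_scheme \<Rightarrow> 'a \<Rightarrow> 'a set"
  where "centralizer T a = {x \<in> carrier T. x \<otimes>\<^bsub>T\<^esub> a = a \<otimes>\<^bsub>T\<^esub> x}"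

lemma (in group) subgroup_centralizer:
  assumes "a \<in> carrier G"
  shows "subgroup (centralizer G a) G"
proof (rule subgroupI)
  show "centralizer G a \<subseteq> carrier G" by (auto simp: centralizer_def)
  show "centralizer G a \<noteq> {}" using assms by (auto simp: centralizer_def)
next
  fix x assume "x \<in> centralizer G a"
  then have x: "x \<in> carrier G" "x \<otimes> a = a \<otimes> x" by (auto simp: centralizer_def)
  have "inv x \<otimes> a = inv x \<otimes> (a \<otimes> x) \<otimes> inv x" using x assms by (simp add: m_assoc)
  also have "\<dots> = inv x \<otimes> (x \<otimes> a) \<otimes> inv x" using x by simp
  also have "\<dots> = a \<otimes> inv x" using x(1) assms by (simp add: m_assoc[symmetric])
  finally show "inv x \<in> centralizer G a" using x by (simp add: centralizer_def)
next
  fix x y assume "x \<in> centralizer G a" "y \<in> centralizer G a"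
  then have x: "x \<in> carrier G" "x \<otimes> a = a \<otimes> x" "y \<in> carrier G" "y \<otimes> a = a \<otimes> y"
    by (auto simp: centralizer_def)
  have "x \<otimes> y \<otimes> a = x \<otimes> (a \<otimes> y)" using x assms by (simp add: m_assoc)
  also have "\<dots> = a \<otimes> (x \<otimes> y)" using x assms by (simp add: m_assoc[symmetric])
  finally show "x \<otimes> y \<in> centralizer G a" using x by (simp add: centralizer_def)
qed

lemma (in group) normal_centre: "(\<Inter>y\<in>carrier G. centralizer G y) \<lhd> G"
  unfolding normal_inv_iff
proof (intro conjI ballI)
  show "subgroup (\<Inter>y\<in>carrier G. centralizer G y) G"
    using subgroups_Inter[of "centralizer G ` carrier G"] subgroup_centralizer by auto
  fix x z assume x: "x \<in> carrier G" and z: "z \<in> (\<Inter>y\<in>carrier G. centralizer G y)"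
  then have "z \<in> carrier G" "z \<otimes> x = x \<otimes> z" by (auto simp: centralizer_def)
  then have "x \<otimes> z \<otimes> inv x = z" using x by (metis inv_solve_right' m_closed)
  then show "x \<otimes> z \<otimes> inv x \<in> (\<Inter>y\<in>carrier G. centralizer G y)" using z by simp
qed

lemma (in group) mem_conjugate_iff:
  assumes "g \<in> carrier G" "M \<subseteq> carrier G"
  shows "x \<in> g <# M #> inv g \<longleftrightarrow> x \<in> carrier G \<and> inv g \<otimes> x \<otimes> g \<in> M"
proof
  assume "x \<in> g <# M #> inv g"
  then obtain m where m: "m \<in> M" "x = g \<otimes> m \<otimes> inv g"
    by (auto simp: l_coset_def r_coset_def)
  moreover have "m \<in> carrier G" using m assms by auto
  moreover have "inv g \<otimes> x \<otimes> g = m"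
    using m(2) assms \<open>m \<in> carrier G\<close> by (simp add: m_assoc inv_solve_left')
  ultimately show "x \<in> carrier G \<and> inv g \<otimes> x \<otimes> g \<in> M" using assms by simp
next
  assume x: "x \<in> carrier G \<and> inv g \<otimes> x \<otimes> g \<in> M"
  moreover have "x = g \<otimes> (inv g \<otimes> x \<otimes> g) \<otimes> inv g"
    using x assms by (simp add: m_assoc inv_solve_right)
      (simp add: m_assoc[symmetric])
  ultimately show "x \<in> g <# M #> inv g"
    unfolding l_coset_def r_coset_def by blast
qed

lemma (in group) conjugate_centralizer:
  assumes "g \<in> carrier G" "a \<in> carrier G"
  shows "g <# centralizer G a #> inv g = centralizer G (g \<otimes> a \<otimes> inv g)"
proof -
  have "inv g \<otimes> x \<otimes> g \<in> centralizer G a \<longleftrightarrow> x \<in> centralizer G (g \<otimes> a \<otimes> inv g)"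
    if x: "x \<in> carrier G" for x
  proof -
    have "inv g \<otimes> x \<otimes> g \<otimes> a = a \<otimes> (inv g \<otimes> x \<otimes> g)
        \<longleftrightarrow> g \<otimes> (inv g \<otimes> x \<otimes> g \<otimes> a) \<otimes> inv g = g \<otimes> (a \<otimes> (inv g \<otimes> x \<otimes> g)) \<otimes> inv g"
      using assms x by simp
    also have "g \<otimes> (inv g \<otimes> x \<otimes> g \<otimes> a) \<otimes> inv g = x \<otimes> (g \<otimes> a \<otimes> inv g)"
      using assms x by (simp add: m_assoc[symmetric])
    also have "g \<otimes> (a \<otimes> (inv g \<otimes> x \<otimes> g)) \<otimes> inv g = g \<otimes> a \<otimes> inv g \<otimes> x"
      using assms x by (simp add: m_assoc)
    finally show ?thesis using assms x by (simp add: centralizer_def)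
  qed
  then show ?thesis
    using mem_conjugate_iff[of g "centralizer G a"] assms
    by (auto simp: centralizer_def)
qed

lemma (in group) card_conjugate:
  assumes "g \<in> carrier G" "M \<subseteq> carrier G"
  shows "card (g <# M #> inv g) = card M"
proof -
  have "g <# M #> inv g = (\<lambda>m. g \<otimes> m \<otimes> inv g) ` M"
    by (auto simp: l_coset_def r_coset_def)
  moreover have "inj_on (\<lambda>m. g \<otimes> m \<otimes> inv g) M"
    using assms by (intro inj_onI) (metis inv_closed m_closed r_cancel l_cancel subsetD)
  ultimately show ?thesis by (simp add: card_image)
qed

section \<open>Groups in which all centralizers are inverted by endomorphisms\<close>

text \<open>
  The abbreviation repeats the term in the definition of \<^const>\<open>normalizer\<close>, so that normalizers of
  subsets are literally stabilizers of this action.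
\<close>

abbreviation subset_conjugation :: "('a, 'b) monoid_scheme \<Rightarrow> 'a \<Rightarrow> 'a set \<Rightarrow> 'a set"
  where "subset_conjugation T \<equiv>
    \<lambda>g. \<lambda>H \<in> {H. H \<subseteq> carrier T}. g <#\<^bsub>T\<^esub> H #>\<^bsub>T\<^esub> (inv\<^bsub>T\<^esub> g)"

text \<open>
  The hypothetical situation to be refuted: every non-commuting pair \<open>a\<close>, \<open>b\<close> is bad, in that some
  endomorphism inverts \<open>b\<close> together with the whole centralizer of \<open>a\<close>. The assumptions are
  contradictory, as shown at the end of the locale.
\<close>

locale centralizer_inverting = group G for G (structure) +
  assumes finite_carrier: "finite (carrier G)"
    and nontrivial: "carrier G \<noteq> {\<one>}"
    and not_normal: "\<lbrakk>a \<in> carrier G; a \<noteq> \<one>\<rbrakk> \<Longrightarrow> \<not> centralizer G a \<lhd> G"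
    and inverting: "\<lbrakk>a \<in> carrier G; b \<in> carrier G; a \<otimes> b \<noteq> b \<otimes> a\<rbrakk> \<Longrightarrow>
      \<exists>\<alpha>\<in>hom G G. (\<forall>c\<in>centralizer G a. \<alpha> c = inv c) \<and> \<alpha> b = inv b"
begin

abbreviation C :: "'a \<Rightarrow> 'a set" where "C \<equiv> centralizer G"

lemma C_subset: "C a \<subseteq> carrier G"
  by (auto simp: centralizer_def)

lemma ex_noncommuting:
  assumes "a \<in> carrier G" "a \<noteq> \<one>"
  shows "\<exists>b\<in>carrier G. a \<otimes> b \<noteq> b \<otimes> a"
proof (rule ccontr)
  assume "\<not> ?thesis"
  then have "C a = carrier G" by (auto simp: centralizer_def)
  moreover have "carrier G \<lhd> G"
    by (simp add: normal_inv_iff subgroup_self)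
  ultimately show False using not_normal[OF assms] by simp
qed

text \<open>
  Inversion agrees with a homomorphism on \<open>C a\<close>, and inversion is multiplicative only on abelian
  groups.
\<close>

lemma C_abelian:
  assumes "a \<in> carrier G" "a \<noteq> \<one>" "c \<in> C a" "d \<in> C a"
  shows "c \<otimes> d = d \<otimes> c"
proof -
  obtain b where "b \<in> carrier G" "a \<otimes> b \<noteq> b \<otimes> a" using ex_noncommuting assms by blast
  then obtain \<alpha> where \<alpha>: "\<alpha> \<in> hom G G" "\<forall>c\<in>C a. \<alpha> c = inv c"
    using inverting assms by blast
  have cd: "c \<in> carrier G" "d \<in> carrier G" using assms by (auto simp: centralizer_def)
  have "d \<otimes> c \<in> C a"
    using subgroup_centralizer assms by (simp add: subgroup.m_closed)
  then have "inv (d \<otimes> c) = \<alpha> d \<otimes> \<alpha> c"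
    using \<alpha> hom_mult[OF \<alpha>(1)] cd by auto
  also have "\<dots> = inv d \<otimes> inv c" using \<alpha> assms by simp
  finally have "inv (d \<otimes> c) = inv (c \<otimes> d)" using cd by (simp add: inv_mult_group)
  then show ?thesis using cd by (metis inv_inv m_closed)
qed

text \<open>
  Consequently the centralizers of non-trivial elements partition the non-trivial elements.
\<close>

lemma C_eq:
  assumes "a \<in> carrier G" "a \<noteq> \<one>" "c \<in> C a" "c \<noteq> \<one>"
  shows "C c = C a"
proof
  have c: "c \<in> carrier G" using assms by (auto simp: centralizer_def)
  have "a \<in> C c" using assms by (auto simp: centralizer_def)
  then show "C c \<subseteq> C a"
    using C_abelian[OF c assms(4)] by (auto simp: centralizer_def)
  show "C a \<subseteq> C c"
    using C_abelian[OF assms(1,2) _ assms(3)] by (auto simp: centralizer_def)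
qed

text \<open>
  If \<open>n\<close> normalizes \<open>C a\<close>, apply an endomorphism that inverts \<open>C a\<close> and \<open>n\<close> to \<open>x n = n m\<close>, where
  \<open>x\<close> is the conjugate of \<open>m\<close>: this gives \<open>n x = m n\<close>, so conjugation by \<open>n\<close> exchanges \<open>m\<close> and \<open>x\<close>.
  Hence \<open>n\<close> commutes with the product \<open>x m\<close>, which must be trivial because \<open>n\<close> lies outside \<open>C a\<close>.
\<close>

lemma normalizing_inverts:
  assumes "a \<in> carrier G" "a \<noteq> \<one>" "n \<in> carrier G" "n \<notin> C a"
    and norm: "\<And>m. m \<in> C a \<Longrightarrow> n \<otimes> m \<otimes> inv n \<in> C a" and m: "m \<in> C a"
  shows "n \<otimes> m \<otimes> inv n = inv m"
proof -
  define x where "x = n \<otimes> m \<otimes> inv n"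
  have mc: "m \<in> carrier G" using m by (simp add: centralizer_def)
  have x: "x \<in> C a" using norm m x_def by simp
  have xc: "x \<in> carrier G" using x by (simp add: centralizer_def)
  have "a \<otimes> n \<noteq> n \<otimes> a" using assms by (auto simp: centralizer_def)
  then obtain \<alpha> where \<alpha>: "\<alpha> \<in> hom G G" "\<forall>c\<in>C a. \<alpha> c = inv c" "\<alpha> n = inv n"
    using inverting assms by blast
  have nm: "x \<otimes> n = n \<otimes> m" using mc assms by (simp add: x_def m_assoc)
  then have "\<alpha> x \<otimes> \<alpha> n = \<alpha> n \<otimes> \<alpha> m"
    using hom_mult[OF \<alpha>(1)] mc xc assms by metis
  then have "inv x \<otimes> inv n = inv n \<otimes> inv m" using \<alpha> m x by simp
  then have "inv (n \<otimes> x) = inv (m \<otimes> n)" using mc xc assms by (simp add: inv_mult_group)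
  then have mn: "n \<otimes> x = m \<otimes> n" using mc xc assms by (metis inv_inv m_closed)
  have "x \<otimes> m \<otimes> n = n \<otimes> (m \<otimes> x)"
  proof -
    have "x \<otimes> m \<otimes> n = x \<otimes> n \<otimes> x" using mn mc xc assms by (simp add: m_assoc)
    then show ?thesis using nm mc xc assms by (simp add: m_assoc)
  qed
  also have "m \<otimes> x = x \<otimes> m" using C_abelian assms m x by blast
  finally have "n \<in> C (x \<otimes> m)" using assms by (simp add: centralizer_def)
  moreover have "x \<otimes> m \<in> C a"
    using subgroup_centralizer[OF assms(1)] x m by (simp add: subgroup.m_closed)
  ultimately have "x \<otimes> m = \<one>"
    using C_eq assms by blast
  then show ?thesis using mc xc x_def by (simp add: inv_equality)
qed

lemma card_C_ge_2:
  assumes "a \<in> carrier G" "a \<noteq> \<one>"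
  shows "2 \<le> card (C a)"
proof -
  have "{\<one>, a} \<subseteq> C a" using assms by (auto simp: centralizer_def)
  moreover have "finite (C a)" using finite_carrier C_subset finite_subset by blast
  moreover have "card {\<one>, a} = 2" using assms by simp
  ultimately show ?thesis using card_mono[of "C a" "{\<one>, a}"] by simp
qed

lemma mem_normalizer_iff:
  "n \<in> normalizer G (C a) \<longleftrightarrow> n \<in> carrier G \<and> n <# C a #> inv n = C a"
  using C_subset by (auto simp: normalizer_def stabilizer_def)

lemma C_subset_normalizer:
  assumes "a \<in> carrier G"
  shows "C a \<subseteq> normalizer G (C a)"
proof
  fix x assume x: "x \<in> C a"
  then have "x \<in> carrier G" by (simp add: centralizer_def)
  moreover from this have "x \<otimes> a \<otimes> inv x = a"
    using assms x by (simp add: centralizer_def m_assoc)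
  ultimately show "x \<in> normalizer G (C a)"
    using assms by (simp add: mem_normalizer_iff conjugate_centralizer)
qed

text \<open>
  A centralizer of order \<open>2\<close> is self-normalizing, since inverting it is the same as centralizing it.
  This is where the bound \<open>3\<close> in the second case comes from.
\<close>

lemma card_normalizer:
  assumes a: "a \<in> carrier G" "a \<noteq> \<one>"
  shows "card (normalizer G (C a)) = card (C a) \<or>
    card (normalizer G (C a)) = 2 * card (C a) \<and> 3 \<le> card (C a)"
proof (cases "normalizer G (C a) \<subseteq> C a")
  case N: True
  then have "normalizer G (C a) = C a" using C_subset_normalizer[OF a(1)] by blast
  then show ?thesis by simp
next
  case False
  then obtain n where n: "n \<in> carrier G" "n <# C a #> inv n = C a" "n \<notin> C a"
    unfolding subset_iff mem_normalizer_iff by blast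
  have conj: "n' \<otimes> m \<otimes> inv n' = inv m"
    if n': "n' \<in> carrier G" "n' <# C a #> inv n' = C a" "n' \<notin> C a" and m: "m \<in> C a" for n' m
  proof (rule normalizing_inverts[OF a n'(1,3) _ m])
    fix m assume "m \<in> C a"
    then have "n' \<otimes> m \<otimes> inv n' \<in> n' <# C a #> inv n'"
      unfolding l_coset_def r_coset_def by blast
    then show "n' \<otimes> m \<otimes> inv n' \<in> C a" using n' by simp
  qed
  have sub: "subgroup (C a) G" using subgroup_centralizer a by blast
  have aC: "a \<in> C a" using a by (simp add: centralizer_def)
  have fin: "finite (C a)" using finite_carrier C_subset finite_subset by blast
  \<comment> \<open>Two elements that invert \<open>C a\<close> have a product centralizing it.\<close>
  have N: "normalizer G (C a) = C a \<union> (n <# C a)"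
  proof (intro equalityI subsetI)
    fix y assume "y \<in> normalizer G (C a)"
    then have y: "y \<in> carrier G" "y <# C a #> inv y = C a" by (auto simp: mem_normalizer_iff)
    show "y \<in> C a \<union> (n <# C a)"
    proof (cases "y \<in> C a")
      case False
      have "y \<otimes> a \<otimes> inv y = n \<otimes> a \<otimes> inv n" using conj y n False aC by simp
      then have "inv n \<otimes> (y \<otimes> a \<otimes> inv y) \<otimes> y = inv n \<otimes> (n \<otimes> a \<otimes> inv n) \<otimes> y" by simp
      then have "inv n \<otimes> y \<otimes> a = a \<otimes> (inv n \<otimes> y)"
        using y n a by (simp add: m_assoc) (simp add: m_assoc[symmetric])
      then have "inv n \<otimes> y \<in> C a" using y n by (simp add: centralizer_def)
      moreover have "y = n \<otimes> (inv n \<otimes> y)" using y n by (simp add: m_assoc[symmetric])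
      ultimately show ?thesis unfolding l_coset_def by blast
    qed simp
  next
    fix y assume y: "y \<in> C a \<union> (n <# C a)"
    have N: "subgroup (normalizer G (C a)) G" "n \<in> normalizer G (C a)"
      using normalizer_imp_subgroup[OF C_subset] n by (simp_all add: mem_normalizer_iff)
    show "y \<in> normalizer G (C a)"
    proof (cases "y \<in> C a")
      case True
      then show ?thesis using C_subset_normalizer[OF a(1)] by blast
    next
      case False
      then obtain m where "m \<in> C a" "y = n \<otimes> m" using y by (auto simp: l_coset_def)
      then show ?thesis
        using subgroup.m_closed[OF N(1) N(2), of m] C_subset_normalizer[OF a(1)] by auto
    qed
  qed
  have "C a \<inter> (n <# C a) = {}"
  proof -
    have False if "m \<in> C a" "n \<otimes> m \<in> C a" for m
    proof -
      have "n \<otimes> m \<otimes> inv m \<in> C a" 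
        using that sub by (simp add: subgroup.m_closed subgroup.m_inv_closed)
      moreover have "m \<in> carrier G" using that by (simp add: centralizer_def)
      ultimately show False using n by (simp add: m_assoc)
    qed
    then show ?thesis by (auto simp: l_coset_def)
  qed
  moreover have "card (n <# C a) = card (C a)"
  proof -
    have "n <# C a = (\<lambda>m. n \<otimes> m) ` C a" by (auto simp: l_coset_def)
    moreover have "inj_on (\<lambda>m. n \<otimes> m) (C a)"
      using n C_subset by (intro inj_onI) (metis l_cancel subsetD)
    ultimately show ?thesis by (simp add: card_image)
  qed
  moreover have "finite (n <# C a)" using fin by (auto simp: l_coset_def)
  ultimately have "card (normalizer G (C a)) = 2 * card (C a)"
    using N fin by (simp add: card_Un_disjoint)
  moreover have "3 \<le> card (C a)"
  proof (rule ccontr)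
    assume "\<not> ?thesis"
    then have "card (C a) = card {\<one>, a}" using card_C_ge_2 a by force
    moreover have "{\<one>, a} \<subseteq> C a" using a by (auto simp: centralizer_def)
    ultimately have "C a = {\<one>, a}" using fin by (metis card_subset_eq)
    moreover have "inv a \<in> C a" using sub aC by (simp add: subgroup.m_inv_closed)
    ultimately have "inv a = a" using a inv_eq_1_iff by blast
    then have "n \<otimes> a \<otimes> inv n = a" using conj n aC by simp
    then have "n \<otimes> a = a \<otimes> n" using n a by (metis inv_solve_right m_closed)
    then show False using n by (simp add: centralizer_def)
  qed
  ultimately show ?thesis by simp
qed

sublocale conj: group_action G "{H. H \<subseteq> carrier G}" "subset_conjugation G"
  by (rule action_by_conjugation_on_power_set)

abbreviation conjugates :: "'a set \<Rightarrow> 'a set set"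
  where "conjugates \<equiv> orbit G (subset_conjugation G)"

text \<open>
  For non-trivial \<open>a\<close> this is the union of all conjugates of \<open>C a\<close> without the neutral element. It is
  described as a class of the equivalence relation of having conjugate centralizers, which makes
  disjointness of different classes immediate.
\<close>

definition fused :: "'a \<Rightarrow> 'a set"
  where "fused a = {y \<in> carrier G - {\<one>}. C y \<in> conjugates (C a)}"

lemma fused_disjoint:
  assumes "b \<notin> fused a" "b \<in> carrier G" "b \<noteq> \<one>"
  shows "fused a \<inter> fused b = {}"
proof -
  have E: "C x \<in> {H. H \<subseteq> carrier G}" for x using C_subset by simp
  have False if y: "C y \<in> conjugates (C a)" "C y \<in> conjugates (C b)" for y
  proof -
    have "C b \<in> conjugates (C y)" by (rule conj.orbit_sym[OF E E y(2)])
    then have "C b \<in> conjugates (C a)" by (rule conj.orbit_trans[OF E E E y(1)])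
    then show False using assms by (simp add: fused_def)
  qed
  then show ?thesis unfolding fused_def by blast
qed

lemma mem_conjugates_iff:
  assumes "a \<in> carrier G"
  shows "M \<in> conjugates (C a) \<longleftrightarrow> (\<exists>g\<in>carrier G. M = C (g \<otimes> a \<otimes> inv g))"
proof -
  have "conjugates (C a) = {g <# C a #> inv g | g. g \<in> carrier G}"
    using C_subset by (simp add: orbit_def)
  also have "\<dots> = {C (g \<otimes> a \<otimes> inv g) | g. g \<in> carrier G}"
    using conjugate_centralizer[OF _ assms] by blast
  finally show ?thesis by blast
qed

lemma card_fused:
  assumes a: "a \<in> carrier G" "a \<noteq> \<one>"
  shows "card (fused a) = card (conjugates (C a)) * (card (C a) - 1)"
proof -
  have rep: "\<exists>d\<in>carrier G. d \<noteq> \<one> \<and> M = C d \<and> card M = card (C a)"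
    if M: "M \<in> conjugates (C a)" for M
  proof -
    obtain g where g: "g \<in> carrier G" "M = C (g \<otimes> a \<otimes> inv g)"
      using M a mem_conjugates_iff by blast
    have "g \<otimes> a \<otimes> inv g \<noteq> \<one>"
    proof
      assume "g \<otimes> a \<otimes> inv g = \<one>"
      then have "inv (inv g) = g \<otimes> a" using a(1) g(1) by (intro inv_equality) auto
      then have "g \<otimes> a = g \<otimes> \<one>" using g(1) by simp
      then show False using a g(1) l_cancel[of g a \<one>] by blast
    qed
    moreover have "card M = card (C a)"
      using card_conjugate[OF g(1) C_subset[of a]] conjugate_centralizer[OF g(1) a(1)] g(2) by simp
    ultimately show ?thesis using g a by blast
  qed
  have "fused a = (\<Union>M\<in>conjugates (C a). M - {\<one>})"
  proof (intro equalityI subsetI)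
    fix y assume "y \<in> fused a"
    then show "y \<in> (\<Union>M\<in>conjugates (C a). M - {\<one>})"
      by (auto simp: fused_def centralizer_def intro!: bexI[of _ "C y"])
  next
    fix y assume "y \<in> (\<Union>M\<in>conjugates (C a). M - {\<one>})"
    then obtain M where M: "M \<in> conjugates (C a)" "y \<in> M" "y \<noteq> \<one>" by auto
    then obtain d where "d \<in> carrier G" "d \<noteq> \<one>" "M = C d" using rep by blast
    then have "C y = M" "y \<in> carrier G" using M C_eq C_subset[of d] by auto
    then show "y \<in> fused a" using M by (simp add: fused_def)
  qed
  also have "card \<dots> = (\<Sum>M\<in>conjugates (C a). card (M - {\<one>}))"
  proof (rule card_UN_disjoint)
    show "finite (conjugates (C a))" using finite_carrier by (simp add: orbit_def)
    show "\<forall>M\<in>conjugates (C a). finite (M - {\<one>})"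
    proof
      fix M assume "M \<in> conjugates (C a)"
      then obtain d where "M = C d" using rep by blast
      then show "finite (M - {\<one>})"
        using C_subset[of d] finite_carrier by (auto intro: finite_subset)
    qed
    show "\<forall>M\<in>conjugates (C a). \<forall>M'\<in>conjugates (C a). M \<noteq> M' \<longrightarrow> (M - {\<one>}) \<inter> (M' - {\<one>}) = {}"
    proof (intro ballI impI)
      fix M M' assume M: "M \<in> conjugates (C a)" "M' \<in> conjugates (C a)" "M \<noteq> M'"
      obtain d where d: "d \<in> carrier G" "d \<noteq> \<one>" "M = C d" using rep[OF M(1)] by blast
      obtain e where e: "e \<in> carrier G" "e \<noteq> \<one>" "M' = C e" using rep[OF M(2)] by blast
      have "C y = M" "C y = M'" if "y \<in> (M - {\<one>}) \<inter> (M' - {\<one>})" for y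
        using that d e C_eq[of d y] C_eq[of e y] by auto
      then show "(M - {\<one>}) \<inter> (M' - {\<one>}) = {}" using M(3) by blast
    qed
  qed
  also have "\<dots> = (\<Sum>M\<in>conjugates (C a). card (C a) - 1)"
  proof (rule sum.cong)
    fix M assume "M \<in> conjugates (C a)"
    then obtain d where d: "d \<in> carrier G" "M = C d" "card M = card (C a)" using rep by blast
    then have "\<one> \<in> M" by (simp add: centralizer_def)
    then show "card (M - {\<one>}) = card (C a) - 1" using d by (simp add: card_Diff_singleton)
  qed simp
  finally show ?thesis by simp
qed

text \<open>
  Here \<open>m\<close> is the order of \<open>C a\<close> and \<open>q\<close> the number of its conjugates; the latter exceeds \<open>1\<close> because
  \<open>C a\<close> is not normal. The cases distinguish whether \<open>C a\<close> has index \<open>1\<close> or \<open>2\<close> in its normalizer.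
\<close>

lemma card_fused_cases:
  assumes a: "a \<in> carrier G" "a \<noteq> \<one>"
  obtains q m where "2 \<le> q" "card (fused a) = q * (m - 1)"
    "2 \<le> m \<and> q * m = order G \<or> 3 \<le> m \<and> 2 * (q * m) = order G"
proof
  let ?q = "card (conjugates (C a))" and ?m = "card (C a)"
  show "card (fused a) = ?q * (?m - 1)" by (rule card_fused[OF a])
  have stab: "?q * card (normalizer G (C a)) = order G"
    unfolding normalizer_def
    using conj.orbit_stabilizer_theorem[of "C a"] C_subset by simp
  then show "2 \<le> ?m \<and> ?q * ?m = order G \<or> 3 \<le> ?m \<and> 2 * (?q * ?m) = order G"
    using card_normalizer[OF a] card_C_ge_2[OF a] by auto
  have pos: "order G > 0" using finite_carrier order_gt_0_iff_finite by blast
  have "?q \<noteq> 1"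
  proof
    assume "?q = 1"
    then have "card (normalizer G (C a)) = card (carrier G)" using stab by (simp add: order_def)
    moreover have "normalizer G (C a) \<subseteq> carrier G" by (auto simp: mem_normalizer_iff)
    ultimately have N: "normalizer G (C a) = carrier G"
      using finite_carrier by (metis card_subset_eq)
    have "C a \<lhd> G"
      unfolding normal_inv_iff
    proof (intro conjI ballI)
      show "subgroup (C a) G" using subgroup_centralizer a by blast
      fix x h assume x: "x \<in> carrier G" "h \<in> C a"
      then have "x \<otimes> h \<otimes> inv x \<in> x <# C a #> inv x"
        unfolding l_coset_def r_coset_def by blast
      then show "x \<otimes> h \<otimes> inv x \<in> C a" using N x mem_normalizer_iff by blast
    qed
    then show False using not_normal a by blast
  qed
  moreover have "?q \<noteq> 0" using stab pos by (metis mult_0 less_irrefl)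
  ultimately show "2 \<le> ?q" by simp
qed

text \<open>
  The proportion of \<open>fused a\<close> in the group is \<open>(1 - 1/m)/e\<close> with \<open>e\<close> the index of \<open>C a\<close> in its normalizer:
  at least \<open>1/2\<close> for \<open>e = 1\<close>, and at least \<open>1/3\<close> for \<open>e = 2\<close> because then \<open>m\<close> is at least \<open>3\<close>.
\<close>

lemma fused_large:
  assumes a: "a \<in> carrier G" "a \<noteq> \<one>"
  shows "order G \<le> 3 * card (fused a)"
proof -
  obtain q m where qm: "2 \<le> q" "card (fused a) = q * (m - 1)"
    "2 \<le> m \<and> q * m = order G \<or> 3 \<le> m \<and> 2 * (q * m) = order G"
    using card_fused_cases a by blast
  have "q * (m - 1) + q = q * m" using qm by (cases m) auto
  moreover have "q * 2 \<le> q * m" using qm by auto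
  moreover have "q * 3 \<le> q * m" if "3 \<le> m" using that by simp
  ultimately show ?thesis using qm by linarith
qed

lemma fused_not_everything:
  assumes a: "a \<in> carrier G" "a \<noteq> \<one>"
  shows "card (fused a) + 1 < order G"
proof -
  obtain q m where qm: "2 \<le> q" "card (fused a) = q * (m - 1)"
    "2 \<le> m \<and> q * m = order G \<or> 3 \<le> m \<and> 2 * (q * m) = order G"
    using card_fused_cases a by blast
  then have "q * (m - 1) + q = q * m" by (cases m) auto
  then show ?thesis using qm by linarith
qed

text \<open>
  With both indices \<open>1\<close> the two classes are too large together, and with both indices \<open>2\<close> they are too
  small. In the mixed case, equality means \<open>q + r = n/2 + 1\<close> where \<open>n\<close> is the order of the group,
  \<open>q = n/m\<close> and \<open>r = n/(2l) \<le> n/6\<close>. This forces \<open>m = 2\<close>, hence \<open>r = 1\<close>, which would make a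
  centralizer normal.
\<close>

lemma two_fused_not_everything:
  assumes a: "a \<in> carrier G" "a \<noteq> \<one>" and b: "b \<in> carrier G" "b \<noteq> \<one>"
  shows "card (fused a) + card (fused b) + 1 \<noteq> order G"
proof -
  obtain q m where qm: "2 \<le> q" "card (fused a) = q * (m - 1)"
    "2 \<le> m \<and> q * m = order G \<or> 3 \<le> m \<and> 2 * (q * m) = order G"
    using card_fused_cases a by blast
  obtain r l where rl: "2 \<le> r" "card (fused b) = r * (l - 1)"
    "2 \<le> l \<and> r * l = order G \<or> 3 \<le> l \<and> 2 * (r * l) = order G"
    using card_fused_cases b by blast
  have f: "q * (m - 1) + q = q * m" using qm(3) by (cases m) auto
  have f': "r * (l - 1) + r = r * l" using rl(3) by (cases l) auto
  \<comment> \<open>Stated for arbitrary numbers because it is used with the roles of the classes exchanged.\<close>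
  have mixed: "q * (m - 1) + r * (l - 1) + 1 \<noteq> order G"
    if "2 \<le> m" "q * m = order G" "3 \<le> l" "2 * (r * l) = order G" "2 \<le> r"
      "q * (m - 1) + q = q * m" "r * (l - 1) + r = r * l" for q m r l
  proof
    assume eq: "q * (m - 1) + r * (l - 1) + 1 = order G"
    have "r * 3 \<le> r * l" using that by simp
    moreover have "m = 2 \<or> 3 * q \<le> order G"
    proof (cases "m = 2")
      case False
      then have "q * 3 \<le> q * m" using that by (intro mult_left_mono) auto
      then show ?thesis using that by simp
    qed simp
    moreover have "q * 2 = order G" if "m = 2" using \<open>q * m = order G\<close> that by simp
    ultimately show False using that eq by linarith
  qed
  have "q * 2 \<le> q * m" "r * 2 \<le> r * l" using qm rl by auto
  moreover have "q * (m - 1) + r * (l - 1) + 1 \<noteq> order G"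
    using qm(3)
  proof
    assume A: "2 \<le> m \<and> q * m = order G"
    from rl(3) show ?thesis
    proof
      assume "2 \<le> l \<and> r * l = order G"
      then show ?thesis using A f f' \<open>q * 2 \<le> q * m\<close> \<open>r * 2 \<le> r * l\<close> by linarith
    next
      assume "3 \<le> l \<and> 2 * (r * l) = order G"
      then show ?thesis using mixed[of m q l r] A f f' rl(1) by blast
    qed
  next
    assume A: "3 \<le> m \<and> 2 * (q * m) = order G"
    from rl(3) show ?thesis
    proof
      assume "2 \<le> l \<and> r * l = order G"
      then show ?thesis using mixed[of l r m q] A f f' qm(1) by (metis add.commute)
    next
      assume "3 \<le> l \<and> 2 * (r * l) = order G"
      then show ?thesis using A f f' qm(1) rl(1) by linarith
    qed
  qed
  ultimately show ?thesis using qm rl by simp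
qed

text \<open>
  One or two classes do not exhaust the non-trivial elements, so there are three disjoint classes.
  Each contains at least a third of the group, but together they miss the neutral element.
\<close>

lemma contradiction: False
proof -
  have fin: "finite (fused x)" for x using finite_carrier by (simp add: fused_def)
  have sub: "fused x \<subseteq> carrier G - {\<one>}" for x by (auto simp: fused_def)
  have total: "card (carrier G - {\<one>}) + 1 = order G"
    unfolding order_def using finite_carrier
    by (metis Suc_eq_plus1 card_Suc_Diff1 one_closed)
  obtain a where a: "a \<in> carrier G" "a \<noteq> \<one>" using nontrivial one_closed by blast
  have "fused a \<noteq> carrier G - {\<one>}" using total fused_not_everything[OF a] by (metis less_irrefl)
  then obtain b where b: "b \<in> carrier G" "b \<noteq> \<one>" "b \<notin> fused a" using sub[of a] by blast
  have ab: "fused a \<inter> fused b = {}" using fused_disjoint b by blast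
  have "fused a \<union> fused b \<noteq> carrier G - {\<one>}"
    using total two_fused_not_everything[OF a b(1,2)] card_Un_disjoint[OF fin fin ab] by metis
  then obtain c where c: "c \<in> carrier G" "c \<noteq> \<one>" "c \<notin> fused a" "c \<notin> fused b"
    using sub[of a] sub[of b] by blast
  have "(fused a \<union> fused b) \<inter> fused c = {}" using fused_disjoint c by blast
  then have "card (fused a \<union> fused b \<union> fused c) = card (fused a) + card (fused b) + card (fused c)"
    using ab fin by (simp add: card_Un_disjoint)
  moreover have "card (fused a \<union> fused b \<union> fused c) \<le> card (carrier G - {\<one>})"
    using sub finite_carrier by (intro card_mono) auto
  ultimately show False
    using total fused_large[OF a] fused_large[OF b(1,2)] fused_large[OF c(1,2)] by linarith
qed

end

lemma (in simple_group) centreless: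
  assumes "\<not> comm_group G" "a \<in> carrier G" "\<And>x. x \<in> carrier G \<Longrightarrow> a \<otimes> x = x \<otimes> a"
  shows "a = \<one>"
proof (rule ccontr)
  assume "a \<noteq> \<one>"
  have "a \<in> (\<Inter>y\<in>carrier G. centralizer G y)"
    using assms by (simp add: centralizer_def)
  then have "(\<Inter>y\<in>carrier G. centralizer G y) = carrier G"
    using no_real_normal_subgroup[OF normal_centre] \<open>a \<noteq> \<one>\<close> by blast
  then have "x \<otimes> y = y \<otimes> x" if "x \<in> carrier G" "y \<in> carrier G" for x y
    using that unfolding centralizer_def by blast
  then show False using assms(1) group_comm_groupI by blast
qed

text \<open>
  In a simple group a centralizer that is normal belongs to a central element, so a counterexample
  would be an instance of the contradictory locale.
\<close>

lemma (in simple_group) ex_noncommuting_not_inverted: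
  assumes "finite (carrier G)" "\<not> comm_group G"
  shows "\<exists>a\<in>carrier G. \<exists>b\<in>carrier G. a \<otimes> b \<noteq> b \<otimes> a \<and>
    \<not> (\<exists>\<alpha>\<in>hom G G. (\<forall>c\<in>centralizer G a. \<alpha> c = inv c) \<and> \<alpha> b = inv b)"
proof (rule ccontr)
  assume "\<not> ?thesis"
  then have inverting: "\<exists>\<alpha>\<in>hom G G. (\<forall>c\<in>centralizer G a. \<alpha> c = inv c) \<and> \<alpha> b = inv b"
    if "a \<in> carrier G" "b \<in> carrier G" "a \<otimes> b \<noteq> b \<otimes> a" for a b
    using that by blast
  have not_normal: "\<not> centralizer G a \<lhd> G" if a: "a \<in> carrier G" "a \<noteq> \<one>" for a
  proof
    assume "centralizer G a \<lhd> G"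
    moreover have "a \<in> centralizer G a" using a by (simp add: centralizer_def)
    ultimately have "centralizer G a = carrier G"
      using no_real_normal_subgroup a by blast
    then have "x \<in> centralizer G a" if "x \<in> carrier G" for x using that by simp
    then have "a \<otimes> x = x \<otimes> a" if "x \<in> carrier G" for x
      using that by (simp add: centralizer_def)
    then show False using centreless assms(2) a by blast
  qed
  interpret centralizer_inverting G
    using assms(1) simple_not_triv not_normal inverting
    by unfold_locales
  show False by (rule contradiction)
qed

section \<open>The wreath product and inner automorphisms\<close>

lemma mult_wreath_sym:
  "(f, \<sigma>) \<otimes>\<^bsub>wreath_sym A k\<^esub> (g, \<tau>) =
    (\<lambda>i\<in>{1..k}. f i \<otimes>\<^bsub>A\<^esub> g (inv_into UNIV \<sigma> i), \<sigma> \<circ> \<tau>)"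
  by (auto simp: wreath_sym_def sym_group_mult intro!: restrict_ext)

lemma carrier_wreath_sym:
  "carrier (wreath_sym A k) = (\<Pi>\<^sub>E i\<in>{1..k}. carrier A) \<times> {\<sigma>. \<sigma> permutes {1..k}}"
  by (simp add: wreath_sym_def sym_group_def)

lemma one_wreath_sym: "\<one>\<^bsub>wreath_sym A k\<^esub> = (\<lambda>i\<in>{1..k}. \<one>\<^bsub>A\<^esub>, id)"
  by (simp add: wreath_sym_def sym_group_one)

lemma group_wreath_sym:
  assumes "group A"
  shows "group (wreath_sym A k)"
proof -
  interpret A: group A by fact
  have mem: "inv_into UNIV \<sigma> i \<in> {1..k}" if "\<sigma> permutes {1..k}" "i \<in> {1..k}" for \<sigma> i
    using permutes_in_image[OF permutes_inv[OF that(1)]] that(2) by blast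
  show ?thesis
  proof (rule groupI)
    fix x y assume "x \<in> carrier (wreath_sym A k)" "y \<in> carrier (wreath_sym A k)"
    then obtain f \<sigma> g \<tau> where xy: "x = (f, \<sigma>)" "y = (g, \<tau>)"
      "f \<in> (\<Pi>\<^sub>E i\<in>{1..k}. carrier A)" "g \<in> (\<Pi>\<^sub>E i\<in>{1..k}. carrier A)"
      "\<sigma> permutes {1..k}" "\<tau> permutes {1..k}"
      unfolding carrier_wreath_sym by blast
    have "f i \<otimes>\<^bsub>A\<^esub> g (inv_into UNIV \<sigma> i) \<in> carrier A" if "i \<in> {1..k}" for i
      using PiE_mem[OF xy(3) that] PiE_mem[OF xy(4) mem[OF xy(5) that]] by simp
    then show "x \<otimes>\<^bsub>wreath_sym A k\<^esub> y \<in> carrier (wreath_sym A k)"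
      using permutes_compose[OF xy(6,5)]
      by (simp add: xy(1,2) mult_wreath_sym carrier_wreath_sym)
  next
    show "\<one>\<^bsub>wreath_sym A k\<^esub> \<in> carrier (wreath_sym A k)"
      by (simp add: one_wreath_sym carrier_wreath_sym permutes_id)
  next
    fix x y z
    assume "x \<in> carrier (wreath_sym A k)" "y \<in> carrier (wreath_sym A k)"
      "z \<in> carrier (wreath_sym A k)"
    then obtain f \<sigma> g \<tau> h \<rho> where xy: "x = (f, \<sigma>)" "y = (g, \<tau>)" "z = (h, \<rho>)"
      "f \<in> (\<Pi>\<^sub>E i\<in>{1..k}. carrier A)" "g \<in> (\<Pi>\<^sub>E i\<in>{1..k}. carrier A)"
      "h \<in> (\<Pi>\<^sub>E i\<in>{1..k}. carrier A)"
      "\<sigma> permutes {1..k}" "\<tau> permutes {1..k}"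
      unfolding carrier_wreath_sym by blast
    have inv: "inv_into UNIV (\<sigma> \<circ> \<tau>) i = inv_into UNIV \<tau> (inv_into UNIV \<sigma> i)" for i
      using o_inv_distrib[OF permutes_bij[OF xy(7)] permutes_bij[OF xy(8)]] by simp
    have "f i \<otimes>\<^bsub>A\<^esub> g (inv_into UNIV \<sigma> i) \<otimes>\<^bsub>A\<^esub> h (inv_into UNIV \<tau> (inv_into UNIV \<sigma> i)) =
        f i \<otimes>\<^bsub>A\<^esub> (g (inv_into UNIV \<sigma> i) \<otimes>\<^bsub>A\<^esub> h (inv_into UNIV \<tau> (inv_into UNIV \<sigma> i)))"
      if "i \<in> {1..k}" for i
      using PiE_mem[OF xy(4) that] PiE_mem[OF xy(5) mem[OF xy(7) that]]
        PiE_mem[OF xy(6) mem[OF xy(8) mem[OF xy(7) that]]] by (simp add: A.m_assoc)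
    then show "x \<otimes>\<^bsub>wreath_sym A k\<^esub> y \<otimes>\<^bsub>wreath_sym A k\<^esub> z
        = x \<otimes>\<^bsub>wreath_sym A k\<^esub> (y \<otimes>\<^bsub>wreath_sym A k\<^esub> z)"
      using mem[OF xy(7)]
      by (auto simp: xy(1-3) mult_wreath_sym inv comp_assoc intro!: restrict_ext)
  next
    fix x assume "x \<in> carrier (wreath_sym A k)"
    then obtain f \<sigma> where x: "x = (f, \<sigma>)" "f \<in> (\<Pi>\<^sub>E i\<in>{1..k}. carrier A)" "\<sigma> permutes {1..k}"
      unfolding carrier_wreath_sym by blast
    have ext: "(\<lambda>i\<in>{1..k}. f i) = f" using x(2) by (simp add: PiE_def extensional_restrict)
    have "(\<lambda>i\<in>{1..k}. (\<lambda>i\<in>{1..k}. \<one>\<^bsub>A\<^esub>) i \<otimes>\<^bsub>A\<^esub> f (inv_into UNIV id i)) = (\<lambda>i\<in>{1..k}. f i)"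
      using PiE_mem[OF x(2)] by (intro restrict_ext) (simp add: inv_id)
    then show "\<one>\<^bsub>wreath_sym A k\<^esub> \<otimes>\<^bsub>wreath_sym A k\<^esub> x = x"
      unfolding x(1) mult_wreath_sym one_wreath_sym ext by simp
    define y where "y = (\<lambda>i\<in>{1..k}. inv\<^bsub>A\<^esub> f (\<sigma> i), inv_into UNIV \<sigma>)"
    have \<sigma>: "\<sigma> i \<in> {1..k}" if "i \<in> {1..k}" for i
      using permutes_in_image[OF x(3)] that by blast
    have "y \<in> carrier (wreath_sym A k)"
      using PiE_mem[OF x(2) \<sigma>] permutes_inv[OF x(3)] by (simp add: y_def carrier_wreath_sym)
    moreover have "y \<otimes>\<^bsub>wreath_sym A k\<^esub> x = \<one>\<^bsub>wreath_sym A k\<^esub>"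
    proof -
      have "(\<lambda>i\<in>{1..k}. (\<lambda>i\<in>{1..k}. inv\<^bsub>A\<^esub> f (\<sigma> i)) i \<otimes>\<^bsub>A\<^esub> f (inv_into UNIV (inv_into UNIV \<sigma>) i))
          = (\<lambda>i\<in>{1..k}. \<one>\<^bsub>A\<^esub>)"
        using PiE_mem[OF x(2) \<sigma>] permutes_inv_inv[OF x(3)]
        by (intro restrict_ext) simp
      then show ?thesis
        using permutes_inv_o(2)[OF x(3)] by (simp add: x(1) y_def mult_wreath_sym one_wreath_sym)
    qed
    ultimately show "\<exists>y\<in>carrier (wreath_sym A k). y \<otimes>\<^bsub>wreath_sym A k\<^esub> x = \<one>\<^bsub>wreath_sym A k\<^esub>"
      by blast
  qed
qed

lemma finite_wreath_sym:
  assumes "finite (carrier A)"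
  shows "finite (carrier (wreath_sym A k))"
  unfolding carrier_wreath_sym
  using assms by (intro finite_cartesian_product finite_PiE finite_permutations) auto

lemma finite_AutoGroup:
  assumes "finite (carrier T)"
  shows "finite (carrier (AutoGroup T))"
proof (rule finite_subset)
  show "carrier (AutoGroup T) \<subseteq> (\<Pi>\<^sub>E x\<in>carrier T. carrier T)"
    by (auto simp: AutoGroup_def auto_def Bij_def PiE_def dest: bij_betw_imp_funcset)
  show "finite (\<Pi>\<^sub>E x\<in>carrier T. carrier T)" using assms by (intro finite_PiE) auto
qed

lemma finite_diag_points:
  assumes "finite (carrier T)"
  shows "finite (diag_points k T)"
proof -
  have "diag_W0 k T \<subseteq> carrier (wreath_sym (AutoGroup T) k)" by (auto simp: diag_W0_def)
  then have "finite (diag_W0 k T)"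
    using finite_wreath_sym[OF finite_AutoGroup[OF assms]] finite_subset by blast
  then show ?thesis by (simp add: diag_points_def RCOSETS_def)
qed

definition inner_aut :: "('a, 'b) monoid_scheme \<Rightarrow> 'a \<Rightarrow> 'a \<Rightarrow> 'a"
  where "inner_aut T g = (\<lambda>x\<in>carrier T. g \<otimes>\<^bsub>T\<^esub> x \<otimes>\<^bsub>T\<^esub> inv\<^bsub>T\<^esub> g)"

lemma Inn_eq: "Inn T = inner_aut T ` carrier T"
  by (simp add: Inn_def inner_aut_def)

context group
begin

lemma carrier_AutoGroup: "carrier (AutoGroup G) = auto G"
  by (simp add: AutoGroup_def)

lemma mult_AutoGroup:
  "\<alpha> \<in> auto G \<Longrightarrow> \<beta> \<in> auto G \<Longrightarrow> \<alpha> \<otimes>\<^bsub>AutoGroup G\<^esub> \<beta> = compose (carrier G) \<alpha> \<beta>"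
  by (simp add: AutoGroup_def BijGroup_def auto_def)

lemma inner_aut_in_auto:
  assumes "g \<in> carrier G"
  shows "inner_aut G g \<in> auto G"
proof -
  have "inner_aut G g \<in> hom G G"
    unfolding hom_def inner_aut_def using assms
    by (auto simp: m_assoc) (metis inv_closed l_inv m_assoc m_closed l_one)
  moreover have "bij_betw (inner_aut G g) (carrier G) (carrier G)"
    using assms
    by (intro bij_betwI[where g = "inner_aut G (inv g)"])
      (auto simp: inner_aut_def m_assoc[symmetric], auto simp: m_assoc)
  ultimately show ?thesis by (simp add: auto_def Bij_def inner_aut_def)
qed

lemma inner_aut_mult:
  assumes "g \<in> carrier G" "h \<in> carrier G"
  shows "inner_aut G g \<otimes>\<^bsub>AutoGroup G\<^esub> inner_aut G h = inner_aut G (g \<otimes> h)"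
  unfolding mult_AutoGroup[OF inner_aut_in_auto[OF assms(1)] inner_aut_in_auto[OF assms(2)]]
  using assms
  by (auto simp: compose_def inner_aut_def m_assoc inv_mult_group intro!: restrict_ext)

lemma inner_aut_one: "inner_aut G \<one> = \<one>\<^bsub>AutoGroup G\<^esub>"
  by (auto simp: AutoGroup_def BijGroup_def inner_aut_def intro!: restrict_ext)

lemma auto_mult_inner_aut:
  assumes "\<alpha> \<in> auto G" "g \<in> carrier G"
  shows "\<alpha> \<otimes>\<^bsub>AutoGroup G\<^esub> inner_aut G g = inner_aut G (\<alpha> g) \<otimes>\<^bsub>AutoGroup G\<^esub> \<alpha>"
proof -
  have \<alpha>: "group_hom G G \<alpha>" "\<And>x. x \<in> carrier G \<Longrightarrow> \<alpha> x \<in> carrier G"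
    using assms by (auto simp: auto_def group_hom_def group_hom_axioms_def is_group hom_def)
  interpret \<alpha>: group_hom G G \<alpha> by (rule \<alpha>)
  show ?thesis
    unfolding mult_AutoGroup[OF assms(1) inner_aut_in_auto[OF assms(2)]]
      mult_AutoGroup[OF inner_aut_in_auto[OF \<alpha>(2)[OF assms(2)]] assms(1)]
    using assms \<alpha>(2) by (auto simp: compose_def inner_aut_def intro!: restrict_ext)
qed

lemma inner_aut_eq_one:
  assumes "g \<in> carrier G" "inner_aut G g = \<one>\<^bsub>AutoGroup G\<^esub>" "x \<in> carrier G"
  shows "g \<otimes> x = x \<otimes> g"
proof -
  have "g \<otimes> x \<otimes> inv g = x"
    using fun_cong[OF assms(2), of x] assms(3)
    by (simp add: inner_aut_def AutoGroup_def BijGroup_def)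
  then show ?thesis using assms(1,3) by (metis inv_solve_right' m_closed)
qed

lemma subgroup_Inn: "subgroup (Inn G) (AutoGroup G)"
proof -
  have "group_hom G (AutoGroup G) (inner_aut G)"
    using inner_aut_mult inner_aut_in_auto
    by (auto simp: group_hom_def group_hom_axioms_def is_group AutoGroup hom_def carrier_AutoGroup)
  then show ?thesis
    using group_hom.img_is_subgroup[of G "AutoGroup G" "inner_aut G"] by (simp add: Inn_eq)
qed

end

section \<open>The diagonal action\<close>

locale diagonal_action = group T for T (structure) +
  fixes k :: nat
  assumes two_le_k: "2 \<le> k"
    and centreless: "\<lbrakk>z \<in> carrier T; \<And>x. x \<in> carrier T \<Longrightarrow> z \<otimes> x = x \<otimes> z\<rbrakk> \<Longrightarrow> z = \<one>"
begin

abbreviation A where "A \<equiv> AutoGroup T"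

abbreviation W where "W \<equiv> wreath_sym A k"

abbreviation D where "D \<equiv> diag_D0 k T"

sublocale A: group A by (rule AutoGroup)

sublocale W: group W by (rule group_wreath_sym) (rule AutoGroup)

lemma inner_aut_closed [simp]: "g \<in> carrier T \<Longrightarrow> inner_aut T g \<in> carrier A"
  by (simp add: carrier_AutoGroup inner_aut_in_auto)

lemma inner_aut_inj:
  assumes "g \<in> carrier T" "h \<in> carrier T" "inner_aut T g = inner_aut T h"
  shows "g = h"
proof -
  have "inner_aut T (inv h \<otimes> g) = inner_aut T (inv h) \<otimes>\<^bsub>A\<^esub> inner_aut T h"
    using assms by (simp add: inner_aut_mult[symmetric])
  also have "\<dots> = \<one>\<^bsub>A\<^esub>" using assms by (simp add: inner_aut_mult inner_aut_one)
  finally have "inv h \<otimes> g = \<one>"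
    using assms inner_aut_eq_one by (intro centreless) auto
  then show ?thesis using assms by (metis inv_closed inv_equality inv_inv m_closed)
qed

text \<open>
  The coordinate \<open>2\<close> is singled out because \<open>k\<close> is at least \<open>2\<close>; all other coordinates, at least the
  first, carry the same value. These elements form a copy of \<open>T \<times> T\<close> in the base group.
\<close>

definition two_valued :: "'a \<Rightarrow> 'a \<Rightarrow> (nat \<Rightarrow> 'a \<Rightarrow> 'a) \<times> (nat \<Rightarrow> nat)"
  where "two_valued g h = (\<lambda>i\<in>{1..k}. if i = 2 then inner_aut T h else inner_aut T g, id)"

definition point :: "'a \<Rightarrow> ((nat \<Rightarrow> 'a \<Rightarrow> 'a) \<times> (nat \<Rightarrow> nat)) set"
  where "point x = D #>\<^bsub>W\<^esub> two_valued \<one> x"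

lemma two_valued_mult:
  assumes "g \<in> carrier T" "h \<in> carrier T" "g' \<in> carrier T" "h' \<in> carrier T"
  shows "two_valued g h \<otimes>\<^bsub>W\<^esub> two_valued g' h' = two_valued (g \<otimes> g') (h \<otimes> h')"
  using assms
  by (auto simp: two_valued_def mult_wreath_sym inv_id inner_aut_mult intro!: restrict_ext)

lemma two_valued_closed [simp]:
  "g \<in> carrier T \<Longrightarrow> h \<in> carrier T \<Longrightarrow> two_valued g h \<in> carrier W"
  by (auto simp: two_valued_def carrier_wreath_sym permutes_id)

lemma two_valued_one: "two_valued \<one> \<one> = \<one>\<^bsub>W\<^esub>"
  by (auto simp: two_valued_def one_wreath_sym inner_aut_one intro!: restrict_ext)

lemma two_valued_in_base:
  "g \<in> carrier T \<Longrightarrow> h \<in> carrier T \<Longrightarrow> two_valued g h \<in> diag_base k T"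
  by (auto simp: two_valued_def diag_base_def Inn_eq)

lemma two_valued_in_D: "g \<in> carrier T \<Longrightarrow> two_valued g g \<in> D"
  by (auto simp: two_valued_def diag_D0_def sym_group_def permutes_id
      intro!: exI[of _ "inner_aut T g"])

lemma two_valued_in_W0:
  assumes "g \<in> carrier T" "h \<in> carrier T"
  shows "two_valued g h \<in> diag_W0 k T"
proof -
  have "Inn T #>\<^bsub>A\<^esub> inner_aut T x = Inn T" if "x \<in> carrier T" for x
    using that subgroup_Inn by (intro A.coset_join2) (auto simp: Inn_eq)
  then show ?thesis
    using two_valued_closed[OF assms] assms two_le_k by (auto simp: diag_W0_def two_valued_def)
qed

lemma subgroup_D: "subgroup D W"
proof (rule W.subgroupI)
  show "D \<subseteq> carrier W"
    by (auto simp: diag_D0_def carrier_wreath_sym sym_group_def)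
  show "D \<noteq> {}" using two_valued_in_D[of \<one>] by auto
next
  fix x y assume "x \<in> D" "y \<in> D"
  then obtain \<alpha> \<sigma> \<beta> \<tau> where xy: "x = (\<lambda>i\<in>{1..k}. \<alpha>, \<sigma>)" "y = (\<lambda>i\<in>{1..k}. \<beta>, \<tau>)"
    "\<alpha> \<in> carrier A" "\<beta> \<in> carrier A" "\<sigma> permutes {1..k}" "\<tau> permutes {1..k}"
    by (auto simp: diag_D0_def sym_group_def)
  have "inv_into UNIV \<sigma> i \<in> {1..k}" if "i \<in> {1..k}" for i
    using permutes_in_image[OF permutes_inv[OF xy(5)]] that by blast
  then have "x \<otimes>\<^bsub>W\<^esub> y = (\<lambda>i\<in>{1..k}. \<alpha> \<otimes>\<^bsub>A\<^esub> \<beta>, \<sigma> \<circ> \<tau>)"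
    by (auto simp: xy mult_wreath_sym intro!: restrict_ext)
  then show "x \<otimes>\<^bsub>W\<^esub> y \<in> D"
    using xy permutes_compose[OF xy(6,5)] by (auto simp: diag_D0_def sym_group_def)
next
  fix x assume "x \<in> D"
  then obtain \<alpha> \<sigma> where x: "x = (\<lambda>i\<in>{1..k}. \<alpha>, \<sigma>)" "\<alpha> \<in> carrier A" "\<sigma> permutes {1..k}"
    by (auto simp: diag_D0_def sym_group_def)
  define y where "y = (\<lambda>i\<in>{1..k}. inv\<^bsub>A\<^esub> \<alpha>, inv_into UNIV \<sigma>)"
  have "inv_into UNIV (inv_into UNIV \<sigma>) i \<in> {1..k}" if "i \<in> {1..k}" for i
    using permutes_in_image[OF permutes_inv[OF permutes_inv[OF x(3)]]] that by blast
  then have "y \<otimes>\<^bsub>W\<^esub> x = \<one>\<^bsub>W\<^esub>"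
    using x permutes_inv_o(2)[OF x(3)]
    by (auto simp: y_def mult_wreath_sym one_wreath_sym intro!: restrict_ext)
  moreover have "x \<in> carrier W" "y \<in> carrier W"
    using x permutes_inv[OF x(3)] by (auto simp: y_def carrier_wreath_sym)
  ultimately have "inv\<^bsub>W\<^esub> x = y" by (simp add: W.inv_equality)
  then show "inv\<^bsub>W\<^esub> x \<in> D"
    using x permutes_inv[OF x(3)] by (auto simp: y_def diag_D0_def sym_group_def)
qed

lemma D_subset: "D \<subseteq> carrier W"
  using subgroup_D by (rule subgroup.subset)

lemma point_in_diag_points: "x \<in> carrier T \<Longrightarrow> point x \<in> diag_points k T"
  using two_valued_in_W0[of \<one> x]
  by (auto simp: diag_points_def RCOSETS_def point_def r_coset_def)

lemma diag_perm_point: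
  assumes "x \<in> carrier T" "w \<in> carrier W"
  shows "diag_perm k T w (point x) = D #>\<^bsub>W\<^esub> (two_valued \<one> x \<otimes>\<^bsub>W\<^esub> w)"
  using assms point_in_diag_points D_subset
  by (simp add: diag_perm_def point_def W.coset_mult_assoc)

text \<open>
  Left multiplication by the diagonal element of \<open>inv g\<close> brings the product back to the form of a
  representative of a point.
\<close>

lemma diag_perm_two_valued:
  assumes "g \<in> carrier T" "h \<in> carrier T" "x \<in> carrier T"
  shows "diag_perm k T (two_valued g h) (point x) = point (inv g \<otimes> x \<otimes> h)"
proof -
  have "two_valued \<one> x \<otimes>\<^bsub>W\<^esub> two_valued g h
      = two_valued g g \<otimes>\<^bsub>W\<^esub> two_valued \<one> (inv g \<otimes> x \<otimes> h)"
    using assms by (simp add: two_valued_mult) (simp add: m_assoc[symmetric])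
  then have "diag_perm k T (two_valued g h) (point x)
      = D #>\<^bsub>W\<^esub> (two_valued g g \<otimes>\<^bsub>W\<^esub> two_valued \<one> (inv g \<otimes> x \<otimes> h))"
    using assms by (simp add: diag_perm_point)
  also have "\<dots> = D #>\<^bsub>W\<^esub> two_valued g g #>\<^bsub>W\<^esub> two_valued \<one> (inv g \<otimes> x \<otimes> h)"
    using assms D_subset by (simp add: W.coset_mult_assoc)
  also have "D #>\<^bsub>W\<^esub> two_valued g g = D"
    using assms subgroup_D two_valued_in_D by (simp add: W.coset_join2)
  finally show ?thesis by (simp add: point_def)
qed

text \<open>
  An element fixing \<open>point \<one>\<close> lies in \<open>D\<close>, so it is a diagonal automorphism \<open>\<alpha>\<close> followed by a
  permutation \<open>\<tau>\<close> of coordinates. If \<open>\<tau>\<close> fixes the second coordinate, points are moved by \<open>\<alpha>\<close>. Otherwise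
  \<open>x\<close> ends up in another coordinate; for the result to be again one of the points considered,
  moving the non-trivial entry back to the second coordinate by a diagonal factor has to invert it.
  The automorphism takes images to arguments because \<open>\<alpha>\<close> stands to the right of the inner
  automorphisms in the product.
\<close>

lemma stabilizer_of_point_one:
  assumes w: "w \<in> diag_W0 k T" and fix1: "diag_perm k T w (point \<one>) = point \<one>"
  obtains \<alpha> where "\<alpha> \<in> auto T"
    "(\<forall>x\<in>carrier T. \<forall>y\<in>carrier T. diag_perm k T w (point x) = point y \<longrightarrow> x = \<alpha> y) \<or>
     (\<forall>x\<in>carrier T. \<forall>y\<in>carrier T. diag_perm k T w (point x) = point y \<longrightarrow> x = inv (\<alpha> y))"
proof -
  have wW: "w \<in> carrier W" using w by (auto simp: diag_W0_def)
  have "D #>\<^bsub>W\<^esub> w = D"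
    using diag_perm_point[OF one_closed wW] fix1 wW D_subset
    by (simp add: point_def two_valued_one)
  then have "w \<in> D" using W.rcos_self[OF wW subgroup_D] by simp
  then obtain \<alpha> \<tau> where \<alpha>: "w = (\<lambda>i\<in>{1..k}. \<alpha>, \<tau>)" "\<alpha> \<in> carrier A" "\<tau> permutes {1..k}"
    by (auto simp: diag_D0_def sym_group_def)
  have \<alpha>': "\<alpha> \<in> auto T" using \<alpha>(2) by (simp add: carrier_AutoGroup)
  have \<alpha>T: "\<alpha> y \<in> carrier T" if "y \<in> carrier T" for y
    using \<alpha>' that by (auto simp: auto_def hom_def)
  \<comment> \<open>Two elements of one coset of \<open>D\<close>, compared coordinate by coordinate.\<close>
  have key: "\<exists>\<beta>\<in>carrier A. \<forall>i\<in>{1..k}.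
      (if i = 2 then inner_aut T x else \<one>\<^bsub>A\<^esub>) \<otimes>\<^bsub>A\<^esub> \<alpha>
      = \<beta> \<otimes>\<^bsub>A\<^esub> (if inv_into UNIV \<tau> i = 2 then inner_aut T y else \<one>\<^bsub>A\<^esub>)"
    if xy: "x \<in> carrier T" "y \<in> carrier T" "diag_perm k T w (point x) = point y" for x y
  proof -
    have xw: "two_valued \<one> x \<otimes>\<^bsub>W\<^esub> w
        = (\<lambda>i\<in>{1..k}. (if i = 2 then inner_aut T x else \<one>\<^bsub>A\<^esub>) \<otimes>\<^bsub>A\<^esub> \<alpha>, \<tau>)"
      by (auto simp: \<alpha>(1) two_valued_def mult_wreath_sym inv_id inner_aut_one intro!: restrict_ext)
    have "D #>\<^bsub>W\<^esub> (two_valued \<one> x \<otimes>\<^bsub>W\<^esub> w) = D #>\<^bsub>W\<^esub> two_valued \<one> y"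
      using diag_perm_point[OF xy(1) wW] xy(3) by (simp add: point_def)
    then have "two_valued \<one> x \<otimes>\<^bsub>W\<^esub> w \<in> D #>\<^bsub>W\<^esub> two_valued \<one> y"
      using W.rcos_self[OF _ subgroup_D, of "two_valued \<one> x \<otimes>\<^bsub>W\<^esub> w"] wW xy(1) by simp
    then obtain \<beta> \<rho> where \<beta>: "\<beta> \<in> carrier A" "\<rho> permutes {1..k}"
      "two_valued \<one> x \<otimes>\<^bsub>W\<^esub> w = (\<lambda>i\<in>{1..k}. \<beta>, \<rho>) \<otimes>\<^bsub>W\<^esub> two_valued \<one> y"
      by (auto simp: r_coset_def diag_D0_def sym_group_def)
    have mem: "inv_into UNIV \<rho> i \<in> {1..k}" if "i \<in> {1..k}" for i
      using permutes_in_image[OF permutes_inv[OF \<beta>(2)]] that by blast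
    have "(\<lambda>i\<in>{1..k}. \<beta>, \<rho>) \<otimes>\<^bsub>W\<^esub> two_valued \<one> y
        = (\<lambda>i\<in>{1..k}. \<beta> \<otimes>\<^bsub>A\<^esub> (if inv_into UNIV \<rho> i = 2 then inner_aut T y else \<one>\<^bsub>A\<^esub>), \<rho>)"
      using mem unfolding two_valued_def mult_wreath_sym inner_aut_one
      by (auto intro!: restrict_ext)
    with \<beta>(3) xw have eq: "\<tau> = \<rho>"
      "(\<lambda>i\<in>{1..k}. (if i = 2 then inner_aut T x else \<one>\<^bsub>A\<^esub>) \<otimes>\<^bsub>A\<^esub> \<alpha>)
      = (\<lambda>i\<in>{1..k}. \<beta> \<otimes>\<^bsub>A\<^esub> (if inv_into UNIV \<rho> i = 2 then inner_aut T y else \<one>\<^bsub>A\<^esub>))"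
      by simp_all
    show ?thesis
    proof (intro bexI[OF _ \<beta>(1)] ballI)
      fix i assume "i \<in> {1..k}"
      then show "(if i = 2 then inner_aut T x else \<one>\<^bsub>A\<^esub>) \<otimes>\<^bsub>A\<^esub> \<alpha>
        = \<beta> \<otimes>\<^bsub>A\<^esub> (if inv_into UNIV \<tau> i = 2 then inner_aut T y else \<one>\<^bsub>A\<^esub>)"
        using fun_cong[OF eq(2), of i] eq(1) by (simp only: restrict_apply' if_True)
    qed
  qed
  \<comment> \<open>Comparing the coordinates \<open>1\<close>, \<open>2\<close> and \<open>\<tau> 2\<close> is enough to determine \<open>x\<close>.\<close>
  have inv2: "inv_into UNIV \<tau> i = 2 \<longleftrightarrow> i = \<tau> 2" for i
    using permutes_inv_eq[OF \<alpha>(3)] by metis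
  have dom: "1 \<in> {1..k}" "2 \<in> {1..k}" "\<tau> 2 \<in> {1..k}"
    using two_le_k permutes_in_image[OF \<alpha>(3), of 2] by auto
  show thesis
  proof (cases "\<tau> 2 = 2")
    case True
    have "x = \<alpha> y"
      if xy: "x \<in> carrier T" "y \<in> carrier T" "diag_perm k T w (point x) = point y" for x y
    proof -
      obtain \<beta> where \<beta>: "\<beta> \<in> carrier A" "\<forall>i\<in>{1..k}.
          (if i = 2 then inner_aut T x else \<one>\<^bsub>A\<^esub>) \<otimes>\<^bsub>A\<^esub> \<alpha>
          = \<beta> \<otimes>\<^bsub>A\<^esub> (if i = \<tau> 2 then inner_aut T y else \<one>\<^bsub>A\<^esub>)"
        using key[OF xy] unfolding inv2 by blast
      have "\<alpha> = \<beta>" using bspec[OF \<beta>(2) dom(1)] \<beta>(1) \<alpha>(2) True by simp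
      then have "inner_aut T x \<otimes>\<^bsub>A\<^esub> \<alpha> = inner_aut T (\<alpha> y) \<otimes>\<^bsub>A\<^esub> \<alpha>"
        using bspec[OF \<beta>(2) dom(2)] True auto_mult_inner_aut[OF \<alpha>' xy(2)] by simp
      then have "inner_aut T x = inner_aut T (\<alpha> y)"
        using xy \<alpha> \<alpha>T by simp
      then show ?thesis using inner_aut_inj xy \<alpha>T by blast
    qed
    then show thesis using that[OF \<alpha>'] by blast
  next
    case False
    have "x = inv (\<alpha> y)"
      if xy: "x \<in> carrier T" "y \<in> carrier T" "diag_perm k T w (point x) = point y" for x y
    proof -
      obtain \<beta> where \<beta>: "\<beta> \<in> carrier A" "\<forall>i\<in>{1..k}.
          (if i = 2 then inner_aut T x else \<one>\<^bsub>A\<^esub>) \<otimes>\<^bsub>A\<^esub> \<alpha>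
          = \<beta> \<otimes>\<^bsub>A\<^esub> (if i = \<tau> 2 then inner_aut T y else \<one>\<^bsub>A\<^esub>)"
        using key[OF xy] unfolding inv2 by blast
      have h1: "inner_aut T x \<otimes>\<^bsub>A\<^esub> \<alpha> = \<beta>"
        using bspec[OF \<beta>(2) dom(2)] \<beta>(1) False by simp
      have h2: "\<alpha> = \<beta> \<otimes>\<^bsub>A\<^esub> inner_aut T y"
        using bspec[OF \<beta>(2) dom(3)] \<alpha>(2) False by simp
      have "\<alpha> = inner_aut T x \<otimes>\<^bsub>A\<^esub> \<alpha> \<otimes>\<^bsub>A\<^esub> inner_aut T y"
        unfolding h1 by (rule h2)
      then have "\<one>\<^bsub>A\<^esub> \<otimes>\<^bsub>A\<^esub> \<alpha> = inner_aut T x \<otimes>\<^bsub>A\<^esub> (\<alpha> \<otimes>\<^bsub>A\<^esub> inner_aut T y)"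
        using xy \<alpha>(2) by (metis A.l_one A.m_assoc inner_aut_closed)
      also have "\<dots> = inner_aut T (x \<otimes> \<alpha> y) \<otimes>\<^bsub>A\<^esub> \<alpha>"
        using xy \<alpha> \<alpha>T
        by (simp add: auto_mult_inner_aut[OF \<alpha>'] A.m_assoc[symmetric] inner_aut_mult)
      finally have "inner_aut T \<one> = inner_aut T (x \<otimes> \<alpha> y)"
        unfolding inner_aut_one using xy \<alpha> \<alpha>T by (metis A.one_closed A.r_cancel inner_aut_closed m_closed)
      then have "\<one> = x \<otimes> \<alpha> y" using inner_aut_inj xy \<alpha>T by blast
      then show ?thesis using xy \<alpha>T by (simp add: inv_equality)
    qed
    then show thesis using that[OF \<alpha>'] by blast
  qed
qed

end

section \<open>Two tuples that agree on triples\<close>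

text \<open>
  In the application \<open>C\<close> is the centralizer of \<open>a\<close>. Two elements of \<open>insert b C\<close> either both lie in \<open>C\<close>,
  and conjugation by \<open>a\<close> fixes them, or they lie in \<open>{b, c}\<close> for some \<open>c\<close> in \<open>C\<close>, and the map
  \<open>x \<mapsto> b c\<inverse> x b\<inverse> c\<close> does.
\<close>

lemma (in group) ab_to_ba:
  assumes "a \<in> carrier G" "b \<in> carrier G"
    and "\<And>x. x \<in> C \<Longrightarrow> x \<in> carrier G \<and> x \<otimes> a = a \<otimes> x"
    and xy: "x \<in> insert b C" "y \<in> insert b C" and "\<one> \<in> C"
  shows "\<exists>l\<in>carrier G. \<exists>r\<in>carrier G. inv l \<otimes> x \<otimes> r = x \<and> inv l \<otimes> y \<otimes> r = y \<and>
    inv l \<otimes> (a \<otimes> b) \<otimes> r = b \<otimes> a"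
proof (cases "x \<in> C \<and> y \<in> C")
  case True
  then have "inv a \<otimes> x \<otimes> a = x" "inv a \<otimes> y \<otimes> a = y"
    using assms by (simp_all add: m_assoc) (simp_all add: m_assoc[symmetric])
  moreover have "inv a \<otimes> (a \<otimes> b) \<otimes> a = b \<otimes> a"
    using assms by (simp add: m_assoc[symmetric])
  ultimately show ?thesis using assms by blast
next
  case False
  then obtain c where c: "c \<in> C" "x \<in> {b, c}" "y \<in> {b, c}"
    using xy \<open>\<one> \<in> C\<close> by blast
  then have cc: "c \<in> carrier G" "c \<otimes> a = a \<otimes> c" using assms by auto
  define l r where "l = c \<otimes> inv b" and "r = inv b \<otimes> c"
  have l: "inv l = b \<otimes> inv c" using cc assms by (simp add: l_def inv_mult_group)
  have "inv l \<otimes> c \<otimes> r = c" "inv l \<otimes> b \<otimes> r = b"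
    using cc assms by (simp_all add: l r_def m_assoc) (simp_all add: m_assoc[symmetric])
  moreover have "inv l \<otimes> (a \<otimes> b) \<otimes> r = b \<otimes> a"
  proof -
    have "inv l \<otimes> (a \<otimes> b) \<otimes> r = b \<otimes> (inv c \<otimes> (a \<otimes> c))"
      using cc assms by (simp add: l r_def m_assoc) (simp add: m_assoc[symmetric])
    also have "inv c \<otimes> (a \<otimes> c) = a"
      using cc assms by (simp add: cc(2)[symmetric]) (simp add: m_assoc[symmetric])
    finally show ?thesis .
  qed
  moreover have "l \<in> carrier G" "r \<in> carrier G" using cc assms by (auto simp: l_def r_def)
  ultimately show ?thesis using c by blast
qed

context diagonal_action
begin

text \<open>
  Only triples containing the last index need an argument, and for them the other two entries are
  covered by the preceding lemma.
\<close>

lemma tuple_equiv_three_ab_ba: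
  assumes a: "a \<in> carrier T" and b: "b \<in> carrier T" and cs: "set cs = centralizer T a"
    and base: "\<And>g h. g \<in> carrier T \<Longrightarrow> h \<in> carrier T \<Longrightarrow> diag_perm k T (two_valued g h) \<in> G"
  shows "tuple_equiv G 3 (map point (cs @ [b, a \<otimes> b])) (map point (cs @ [b, b \<otimes> a]))"
  unfolding tuple_equiv_def
proof (intro allI impI, elim conjE)
  define xs where "xs = cs @ [b]"
  define n where "n = length xs"
  fix I assume "I \<subseteq> {..<length (map point (cs @ [b, a \<otimes> b]))}" and card: "card I = 3"
  then have I: "I \<subseteq> {..n}" by (auto simp: n_def xs_def)
  have xs: "set xs = insert b (centralizer T a)" "set xs \<subseteq> carrier T"
    using b cs by (auto simp: xs_def centralizer_def)
  have nth: "(cs @ [b, z]) ! i = (if i = n then z else xs ! i)" if "i \<in> I" for i z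
    using I that by (auto simp: xs_def n_def nth_append)
  have less: "i < n" if "i \<in> I" "i \<noteq> n" for i using I that by (auto simp: order_less_le)
  have "\<exists>l\<in>carrier T. \<exists>r\<in>carrier T. \<forall>i\<in>I.
      inv l \<otimes> (cs @ [b, a \<otimes> b]) ! i \<otimes> r = (cs @ [b, b \<otimes> a]) ! i"
  proof (cases "n \<in> I")
    case False
    have "inv \<one> \<otimes> (cs @ [b, a \<otimes> b]) ! i \<otimes> \<one> = (cs @ [b, b \<otimes> a]) ! i" if "i \<in> I" for i
    proof -
      have "i \<noteq> n" using that False by auto
      moreover from this have "xs ! i \<in> carrier T"
        using less[OF that] xs(2) by (auto simp: n_def)
      ultimately show ?thesis using nth[OF that] by simp
    qed
    then show ?thesis by blast
  next
    case True
    then have "card (I - {n}) = 2" using card by simp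
    then obtain i j where ij: "I - {n} = {i, j}" by (auto simp: card_2_iff)
    then have "i < n" "j < n" using less by auto
    then have mem: "xs ! i \<in> insert b (centralizer T a)" "xs ! j \<in> insert b (centralizer T a)"
      using xs(1) nth_mem[of _ xs] by (auto simp: n_def)
    obtain l r where lr: "l \<in> carrier T" "r \<in> carrier T" "inv l \<otimes> xs ! i \<otimes> r = xs ! i"
      "inv l \<otimes> xs ! j \<otimes> r = xs ! j" "inv l \<otimes> (a \<otimes> b) \<otimes> r = b \<otimes> a"
      using ab_to_ba[OF a b _ mem] a by (auto simp: centralizer_def)
    have "inv l \<otimes> (cs @ [b, a \<otimes> b]) ! m \<otimes> r = (cs @ [b, b \<otimes> a]) ! m" if m: "m \<in> I" for m
    proof (cases "m = n")
      case True
      then show ?thesis using nth[OF m] lr(5) by simp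
    next
      case False
      then have "m = i \<or> m = j" using ij m by blast
      then show ?thesis using nth[OF m] lr(3,4) False by auto
    qed
    then show ?thesis using lr(1,2) by blast
  qed
  then obtain l r where lr: "l \<in> carrier T" "r \<in> carrier T" and
    move: "\<And>i. i \<in> I \<Longrightarrow> inv l \<otimes> (cs @ [b, a \<otimes> b]) ! i \<otimes> r = (cs @ [b, b \<otimes> a]) ! i"
    by blast
  have "diag_perm k T (two_valued l r) (map point (cs @ [b, a \<otimes> b]) ! i)
      = map point (cs @ [b, b \<otimes> a]) ! i" if "i \<in> I" for i
  proof -
    have i: "i < length (cs @ [b, a \<otimes> b])" "i < length (cs @ [b, b \<otimes> a])"
      using I that by (auto simp: n_def xs_def)
    have "set (cs @ [b, a \<otimes> b]) \<subseteq> carrier T" using a b cs by (auto simp: centralizer_def)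
    then have "(cs @ [b, a \<otimes> b]) ! i \<in> carrier T" using nth_mem[OF i(1)] by blast
    then show ?thesis
      using diag_perm_two_valued[OF lr] move[OF that]
      unfolding nth_map[OF i(1)] nth_map[OF i(2)] by simp
  qed
  then show "\<exists>g\<in>G. \<forall>i\<in>I. g (map point (cs @ [b, a \<otimes> b]) ! i) = map point (cs @ [b, b \<otimes> a]) ! i"
    using base[OF lr] by blast
qed

text \<open>
  A map taking the second tuple to the first fixes \<open>point \<one>\<close>, as \<open>\<one>\<close> centralizes \<open>a\<close>, so it acts by an
  automorphism or by an automorphism followed by inversion.
\<close>

lemma not_conjugate_ab_ba:
  assumes a: "a \<in> carrier T" and b: "b \<in> carrier T" and cs: "set cs = centralizer T a"
    and ab: "a \<otimes> b \<noteq> b \<otimes> a"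
    and not_inverted: "\<not> (\<exists>\<alpha>\<in>hom T T. (\<forall>c\<in>centralizer T a. \<alpha> c = inv c) \<and> \<alpha> b = inv b)"
    and w: "w \<in> diag_W0 k T"
  shows "map point (cs @ [b, a \<otimes> b]) \<noteq> map (diag_perm k T w) (map point (cs @ [b, b \<otimes> a]))"
proof
  assume "map point (cs @ [b, a \<otimes> b]) = map (diag_perm k T w) (map point (cs @ [b, b \<otimes> a]))"
  then have fix_c: "\<And>c. c \<in> centralizer T a \<Longrightarrow> diag_perm k T w (point c) = point c"
    and fix_b: "diag_perm k T w (point b) = point b"
    and ba: "diag_perm k T w (point (b \<otimes> a)) = point (a \<otimes> b)"
    by (auto simp flip: cs)
  have C: "\<one> \<in> centralizer T a" "a \<in> centralizer T a" "centralizer T a \<subseteq> carrier T"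
    using a by (auto simp: centralizer_def)
  obtain \<alpha> where \<alpha>: "\<alpha> \<in> auto T" and cases:
    "(\<forall>x\<in>carrier T. \<forall>y\<in>carrier T. diag_perm k T w (point x) = point y \<longrightarrow> x = \<alpha> y) \<or>
     (\<forall>x\<in>carrier T. \<forall>y\<in>carrier T. diag_perm k T w (point x) = point y \<longrightarrow> x = inv (\<alpha> y))"
    using stabilizer_of_point_one[OF w fix_c[OF C(1)]] by blast
  have hom: "\<alpha> \<in> hom T T" using \<alpha> by (simp add: auto_def)
  from cases show False
  proof
    assume *: "\<forall>x\<in>carrier T. \<forall>y\<in>carrier T. diag_perm k T w (point x) = point y \<longrightarrow> x = \<alpha> y"
    have "b \<otimes> a = \<alpha> (a \<otimes> b)" "a = \<alpha> a" "b = \<alpha> b"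
      using * ba fix_b fix_c[OF C(2)] a b by blast+
    then show False using hom_mult[OF hom a b] ab by metis
  next
    assume *: "\<forall>x\<in>carrier T. \<forall>y\<in>carrier T. diag_perm k T w (point x) = point y \<longrightarrow> x = inv (\<alpha> y)"
    have "\<alpha> x = inv x" if "x \<in> carrier T" "diag_perm k T w (point x) = point x" for x
    proof -
      have "x = inv (\<alpha> x)" using * that by blast
      moreover have "\<alpha> x \<in> carrier T" using hom that(1) by (auto simp: hom_def)
      ultimately show ?thesis by (metis inv_inv)
    qed
    then show False using not_inverted hom fix_c fix_b b C(3) by blast
  qed
qed

end

theorem theorem2:
  fixes \<Omega> :: "((nat \<Rightarrow> 'a \<Rightarrow> 'a) \<times> (nat \<Rightarrow> nat)) set set"
    and G :: "(((nat \<Rightarrow> 'a \<Rightarrow> 'a) \<times> (nat \<Rightarrow> nat)) set \<Rightarrow>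
               ((nat \<Rightarrow> 'a \<Rightarrow> 'a) \<times> (nat \<Rightarrow> nat)) set) set"
  assumes "diagonal_type \<Omega> G" and "primitive_group \<Omega> G"
  shows "relational_complexity \<Omega> G \<ge> 4"
proof -
  obtain k and T :: "'a monoid" where k: "k \<ge> 2" and T: "simple_group T" "finite (carrier T)"
    "\<not> comm_group T" and \<Omega>: "\<Omega> = diag_points k T" and G: "subgroup G (BijGroup \<Omega>)"
    "diag_perm k T ` diag_base k T \<lhd> perm_group \<Omega> G" "G \<subseteq> diag_perm k T ` diag_W0 k T"
    using assms(1) unfolding diagonal_type_def by blast
  interpret T: simple_group T by (rule T(1))
  interpret diagonal_action T k
  proof unfold_locales
    show "2 \<le> k" by (rule k)
    show "z = \<one>\<^bsub>T\<^esub>" if "z \<in> carrier T" "\<And>x. x \<in> carrier T \<Longrightarrow> z \<otimes>\<^bsub>T\<^esub> x = x \<otimes>\<^bsub>T\<^esub> z" for z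
      using T.centreless[OF T(3)] that by blast
  qed
  have base: "diag_perm k T (two_valued g h) \<in> G" if "g \<in> carrier T" "h \<in> carrier T" for g h
    using two_valued_in_base[OF that] subgroup.subset[OF normal_imp_subgroup[OF G(2)]] by auto
  obtain a b where a: "a \<in> carrier T" and b: "b \<in> carrier T"
    and ab: "a \<otimes>\<^bsub>T\<^esub> b \<noteq> b \<otimes>\<^bsub>T\<^esub> a"
    "\<not> (\<exists>\<alpha>\<in>hom T T. (\<forall>c\<in>centralizer T a. \<alpha> c = inv\<^bsub>T\<^esub> c) \<and> \<alpha> b = inv\<^bsub>T\<^esub> b)"
    using T.ex_noncommuting_not_inverted[OF T(2,3)] by blast
  have "finite (centralizer T a)" using T(2) by (simp add: centralizer_def)
  then obtain cs where cs: "set cs = centralizer T a" using finite_list by blast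
  define \<Lambda> where "\<Lambda> = map point (cs @ [b, a \<otimes>\<^bsub>T\<^esub> b])"
  define \<Sigma> where "\<Sigma> = map point (cs @ [b, b \<otimes>\<^bsub>T\<^esub> a])"
  have "a \<in> set cs" using a by (simp add: cs centralizer_def)
  then have len: "length \<Sigma> = length \<Lambda>" "3 \<le> length \<Lambda>"
    by (auto simp: \<Lambda>_def \<Sigma>_def Suc_le_eq intro: length_pos_if_in_set)
  have "set cs \<subseteq> carrier T" by (auto simp: cs centralizer_def)
  then have sub: "set \<Lambda> \<subseteq> \<Omega>" "set \<Sigma> \<subseteq> \<Omega>"
    using a b point_in_diag_points by (auto simp: \<Lambda>_def \<Sigma>_def \<Omega>)
  have "tuple_equiv G 3 \<Lambda> \<Sigma>"
    unfolding \<Lambda>_def \<Sigma>_def by (rule tuple_equiv_three_ab_ba[OF a b cs base])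
  moreover have "\<not> (\<exists>g\<in>G. \<Lambda> = map g \<Sigma>)"
    using not_conjugate_ab_ba[OF a b cs ab] G(3) unfolding \<Lambda>_def \<Sigma>_def by blast
  ultimately have "3 < relational_complexity \<Omega> G"
    using relational_complexity_greater[OF _ G(1) len sub] finite_diag_points[OF T(2)] \<Omega> by blast
  then show ?thesis by simp
qed

end
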